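(* Let $(\Omega,\mathcal{F},\mathbb{P})$ be a probability space with a filtration $(\mathcal{F}_n)_{n\ge 0}$, and let $f=(f_n)_{n\ge0}$ and $g=(g_n)_{n\ge0}$ be real-valued $(\mathcal{F}_n)$-martingales with difference sequences $df_0=f_0$, $df_n=f_n-f_{n-1}$, $dg_0=g_0$, $dg_n=g_n-g_{n-1}$ ($n\ge1$). Assume $f$ is non-negative and $g$ is differentially subordinate to $f$, i.e. $|dg_n|\le |df_n|$ almost surely for all $n\ge0$. Then $$\|g\|_{p,\infty}\le 2\|f\|_p \quad (0<p<1)$$ and $$\|g\|_{p,\infty}\le \frac{p}{2}(p-1)^{-1/p}\|f\|_p \quad (2\le p<\infty).$$ Both inequalities are sharp, i.e. the constants $2$ and $\frac p2(p-1)^{-1/p}$ cannot be replaced by smaller ones; they are already sharp in the class of pairs where $g$ is a transform of $f$, i.e. $dg_n=v_n\,df_n$ for a predictable real sequence $(v_n)$ with $|v_n|\le1$ a.s. ($v_n$ being $\mathcal{F}_{(n-1)\vee 0}$-measurable).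
   Context: For a martingale $f$ and $p\in(0,\infty)$: $\|f\|_p=\sup_n(\mathbb{E}|f_n|^p)^{1/p}$ and $\|f\|_{p,\infty}=\sup_{\lambda>0}\lambda\,(\mathbb{P}(f^*\ge\lambda))^{1/p}$, where $f^*=\sup_n|f_n|$. *)

theory Defs
  imports "HOL-Probability.Probability"
begin

text \<open>Power of an extended non-negative real with a positive real exponent
  (infinity stays infinity).\<close>
definition epowr :: "ennreal \<Rightarrow> real \<Rightarrow> ennreal" where
  "epowr x a = (if x = \<top> then \<top> else ennreal (enn2real x powr a))"

definition is_filtration :: "'a measure \<Rightarrow> (nat \<Rightarrow> 'a measure) \<Rightarrow> bool" where
  "is_filtration M F \<longleftrightarrow> (\<forall>n. subalgebra M (F n)) \<and>
      (\<forall>n m. n \<le> m \<longrightarrow> sets (F n) \<subseteq> sets (F m))"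

text \<open>Real-valued martingale w.r.t. F: adapted, integrable, and
  E[f (n+1) | F n] = f n, written via integrals over sets of F n.\<close>
definition is_martingale :: "'a measure \<Rightarrow> (nat \<Rightarrow> 'a measure) \<Rightarrow> (nat \<Rightarrow> 'a \<Rightarrow> real) \<Rightarrow> bool" where
  "is_martingale M F f \<longleftrightarrow> is_filtration M F \<and>
      (\<forall>n. f n \<in> borel_measurable (F n) \<and> integrable M (f n)) \<and>
      (\<forall>n. \<forall>A\<in>sets (F n). (\<integral>x\<in>A. f (Suc n) x \<partial>M) = (\<integral>x\<in>A. f n x \<partial>M))"

definition dseq :: "(nat \<Rightarrow> 'a \<Rightarrow> real) \<Rightarrow> nat \<Rightarrow> 'a \<Rightarrow> real" where
  "dseq f n x = (if n = 0 then f 0 x else f n x - f (n - 1) x)"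

definition diff_subordinate :: "'a measure \<Rightarrow> (nat \<Rightarrow> 'a \<Rightarrow> real) \<Rightarrow> (nat \<Rightarrow> 'a \<Rightarrow> real) \<Rightarrow> bool" where
  "diff_subordinate M g f \<longleftrightarrow> (\<forall>n. AE x in M. \<bar>dseq g n x\<bar> \<le> \<bar>dseq f n x\<bar>)"

text \<open>g is a transform of f by a predictable sequence v with |v n| \<le> 1,
  v n being F ((n-1) max 0)-measurable (nat subtraction: 0 - 1 = 0).\<close>
definition is_transform :: "'a measure \<Rightarrow> (nat \<Rightarrow> 'a measure) \<Rightarrow> (nat \<Rightarrow> 'a \<Rightarrow> real) \<Rightarrow> (nat \<Rightarrow> 'a \<Rightarrow> real) \<Rightarrow> bool" where
  "is_transform M F f g \<longleftrightarrow> (\<exists>v :: nat \<Rightarrow> 'a \<Rightarrow> real.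
      (\<forall>n. v n \<in> borel_measurable (F (n - 1))) \<and>
      (\<forall>n. AE x in M. \<bar>v n x\<bar> \<le> 1) \<and>
      (\<forall>n. \<forall>x\<in>space M. dseq g n x = v n x * dseq f n x))"

definition mart_norm :: "'a measure \<Rightarrow> real \<Rightarrow> (nat \<Rightarrow> 'a \<Rightarrow> real) \<Rightarrow> ennreal" where
  "mart_norm M p f = (SUP n. epowr (\<integral>\<^sup>+ x. ennreal (\<bar>f n x\<bar> powr p) \<partial>M) (1 / p))"

definition maxfun :: "(nat \<Rightarrow> 'a \<Rightarrow> real) \<Rightarrow> 'a \<Rightarrow> ennreal" where
  "maxfun f x = (SUP n. ennreal \<bar>f n x\<bar>)"

definition weak_norm :: "'a measure \<Rightarrow> real \<Rightarrow> (nat \<Rightarrow> 'a \<Rightarrow> real) \<Rightarrow> ennreal" where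
  "weak_norm M p f = (SUP l\<in>{0<..}. ennreal l *
      epowr (emeasure M {x \<in> space M. maxfun f x \<ge> ennreal l}) (1 / p))"

end

theory Submission
  imports Defs
begin

text \<open>
  Both inequalities come from Burkholder's method: a function \<open>U\<close> on the phase space of \<open>(f, g)\<close>
  such that \<open>U (f\<^sub>n, g\<^sub>n)\<close>, frozen in a suitable way once \<open>\<bar>g\<bar>\<close> has reached the level 1, is a
  supermartingale that starts non-positive and dominates \<open>1 - K f\<^sup>p\<close> on \<open>\<bar>g\<bar> \<ge> 1\<close> and \<open>- K f\<^sup>p\<close> elsewhere.

  For \<open>p < 1\<close> the weak-type (1,1) function \<open>y\<^sup>2 - x\<^sup>2\<close> (on \<open>x + \<bar>y\<bar> < 1\<close>), continued by \<open>1 - 2 x\<close>, is used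
  conditionally on the first step, and \<open>min 1 (2 f\<^sub>0) \<le> (2 f\<^sub>0)\<^sup>p\<close>.

  For \<open>p > 2\<close> put \<open>s = x + \<bar>y\<bar>\<close> and \<open>c = \<bar>y\<bar> - x\<close>. Moves with \<open>\<bar>dg\<bar> \<le> \<bar>df\<bar>\<close> are exactly those with
  \<open>\<Delta>s \<Delta>c \<le> 0\<close>, so a function of \<open>(s, c)\<close> which is concave in \<open>s\<close>, concave in \<open>c\<close> and has a nonnegative mixed
  derivative lies below its tangent plane along all admissible moves. The function below is linear in
  the direction of \<open>s\<close> to the left of the ray \<open>y = (p - 1) x\<close> and linear in the direction of \<open>c\<close> to the right of it.

  The extremal processes follow that ray: they alternate small steps up along the slope 1 (with a jump
  to \<open>x = 0\<close> as the alternative) and back to the ray along the slope -1 (with a jump to \<open>x = 2 s / p\<close> as the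
  alternative), and finally jump from \<open>s = 1\<close> to \<open>(0, 1)\<close>.
\<close>

section \<open>Concave functions of one variable\<close>

text \<open>The constants are forced by tangency and smooth fit. For fixed \<open>s\<close> and
  \<open>x = (s - c) / 2\<close>, the function
  \<open>s powr p - \<gamma> * x * s powr (p - 1)\<close> is affine in \<open>x\<close>, has the
  value \<open>s powr p\<close> at \<open>x = 0\<close>, and is to touch
  \<open>- K * x powr p\<close>. If contact is at \<open>x = 2 * s / p\<close>, then
  \<open>K = (p / 2) powr p / (p - 1)\<close> and \<open>\<gamma> = p^2 / (2 * (p - 1))\<close>. To
  the left of a ray \<open>x = r * s\<close> it is replaced by \<open>x * F c\<close>, which
  vanishes at \<open>x = 0\<close>. Equality of values and of slopes in \<open>s\<close> on the ray
  reads \<open>\<gamma> * (p - 1) * r^2 - p * r + 1 / 2 = 0\<close>; the above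
  \<open>\<gamma>\<close> is the value for which this equation has a double root, namely
  \<open>r = 1 / p\<close>. Hence the ray \<open>y = (p - 1) * x\<close>, that is
  \<open>c = \<beta> * s\<close> with \<open>\<beta> = 1 - 2 / p\<close>. On this ray both pieces
  also reach the limit of their concavity. The result is not concave in all directions, and its
  formula changes at the ray, at \<open>s = 1\<close> and at \<open>c = \<beta>\<close>. So explicit
  slopes are carried along and glued, instead of working with second derivatives on the whole
  domain.\<close>

lemma powr_ge_tangent:
  fixes z a :: real assumes "0 \<le> z" "1 \<le> a"
  shows "1 + a * (z - 1) \<le> z powr a"
proof (cases "z = 0")
  case True then show ?thesis using assms by simp
next
  case False
  then have z: "z > 0" using assms by simp
  have "convex {0::real<..}" by (rule convex_real_interval)
  then have "a * 1 powr (a-1) * (z - 1) \<le> z powr a - 1 powr a"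
    by (rule f''_imp_f'[where f''="\<lambda>x. a * ((a-1) * x powr (a-1-1))"])
       (use assms z in \<open>auto intro!: derivative_eq_intros\<close>)
  then show ?thesis by (simp add: algebra_simps)
qed

lemma powr_ge_tangent_at:
  fixes z t a :: real assumes "0 \<le> z" "0 < t" "1 \<le> a"
  shows "t powr a + a * t powr (a - 1) * (z - t) \<le> z powr a"
proof -
  have "1 + a * (z/t - 1) \<le> (z/t) powr a" using assms by (intro powr_ge_tangent) auto
  then have "t powr a * (1 + a * (z/t - 1)) \<le> t powr a * (z/t) powr a"
    by (intro mult_left_mono) auto
  also have "\<dots> = z powr a" using assms by (simp add: powr_divide)
  also have "t powr a * (1 + a * (z/t - 1)) = t powr a + a * t powr (a - 1) * (z - t)"
    using assms by (simp add: powr_diff field_simps)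
  finally show ?thesis .
qed

lemma one_plus_powr_le:
  fixes u a :: real assumes "0 \<le> u" "0 < a" "a \<le> 1"
  shows "(1 + u) powr a \<le> 1 + a * u"
proof -
  have "1 + (1/a) * ((1+u) powr a - 1) \<le> ((1+u) powr a) powr (1/a)"
    using assms by (intro powr_ge_tangent) auto
  then show ?thesis using assms by (simp add: powr_powr field_simps)
qed

text \<open>Concavity with a selected slope at every point: the martingale argument needs the slopes
  themselves, and this form allows kinks.\<close>

definition supergrad_on :: "real set \<Rightarrow> (real \<Rightarrow> real) \<Rightarrow> (real \<Rightarrow> real) \<Rightarrow> bool" where
  "supergrad_on S f g \<longleftrightarrow> (\<forall>s\<in>S. \<forall>t\<in>S. f t \<le> f s + g s * (t - s))"

lemma supergrad_onD: "supergrad_on S f g \<Longrightarrow> s \<in> S \<Longrightarrow> t \<in> S \<Longrightarrow> f t \<le> f s + g s * (t - s)"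
  by (auto simp: supergrad_on_def)

lemma supergrad_on_antimono:
  assumes "supergrad_on S f g" "s \<in> S" "t \<in> S" "s < t"
  shows "g t \<le> g s"
proof -
  have "f t \<le> f s + g s * (t - s)" "f s \<le> f t + g t * (s - t)"
    using assms by (auto intro: supergrad_onD)
  then have "g t * (t - s) \<le> g s * (t - s)" by (simp add: algebra_simps)
  then show ?thesis using assms(4) by simp
qed

lemma supergrad_on_cong:
  assumes "\<And>s. s \<in> S \<Longrightarrow> f s = f' s" "\<And>s. s \<in> S \<Longrightarrow> g s = g' s"
  shows "supergrad_on S f g \<longleftrightarrow> supergrad_on S f' g'"
  using assms by (auto simp: supergrad_on_def)

text \<open>Slopes of a concave function decrease, so an estimate past \<open>b\<close> splits at
  \<open>b\<close>. The slope at \<open>b\<close> may be anything between the two one-sided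
  ones.\<close>

lemma supergrad_on_glue:
  assumes l: "supergrad_on (S \<inter> {..b}) f g1" and r: "supergrad_on (S \<inter> {b..}) f g2"
    and b: "b \<in> S"
    and g1: "\<And>s. s \<in> S \<Longrightarrow> s < b \<Longrightarrow> g s = g1 s"
    and g2: "\<And>s. s \<in> S \<Longrightarrow> b < s \<Longrightarrow> g s = g2 s"
    and gb: "g2 b \<le> g b" "g b \<le> g1 b"
  shows "supergrad_on S f g"
  unfolding supergrad_on_def
proof (intro ballI)
  fix s t assume s: "s \<in> S" and t: "t \<in> S"
  consider "s < b" "t \<le> b" | "s < b" "b < t" | "s = b" | "b < s" "b \<le> t" | "b < s" "t < b"
    by linarith
  then show "f t \<le> f s + g s * (t - s)"
  proof cases
    case 1 then show ?thesis using supergrad_onD[OF l, of s t] s t g1 by auto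
  next
    case 2
    have "f t \<le> f b + g2 b * (t - b)" using supergrad_onD[OF r, of b t] b t 2 by auto
    moreover have "f b \<le> f s + g1 s * (b - s)" using supergrad_onD[OF l, of s b] b s 2 by auto
    moreover have "g1 b \<le> g1 s" using supergrad_on_antimono[OF l, of s b] b s 2 by auto
    moreover have "g2 b * (t - b) \<le> g1 s * (t - b)"
      using 2 gb calculation(3) by (intro mult_right_mono) auto
    ultimately show ?thesis using g1[OF s] 2 by (simp add: algebra_simps)
  next
    case 3
    show ?thesis
    proof (cases "t \<le> b")
      case True
      then have "f t \<le> f b + g1 b * (t - b)" using supergrad_onD[OF l, of b t] b t by auto
      moreover have "g1 b * (t - b) \<le> g b * (t - b)" using gb True by (intro mult_right_mono_neg) auto
      ultimately show ?thesis using 3 by simp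
    next
      case False
      then have "f t \<le> f b + g2 b * (t - b)" using supergrad_onD[OF r, of b t] b t by auto
      moreover have "g2 b * (t - b) \<le> g b * (t - b)" using gb False by (intro mult_right_mono) auto
      ultimately show ?thesis using 3 by simp
    qed
  next
    case 4 then show ?thesis using supergrad_onD[OF r, of s t] s t g2 by auto
  next
    case 5
    have "f t \<le> f b + g1 b * (t - b)" using supergrad_onD[OF l, of b t] b t 5 by auto
    moreover have "f b \<le> f s + g2 s * (b - s)" using supergrad_onD[OF r, of s b] b s 5 by auto
    moreover have "g2 s \<le> g2 b" using supergrad_on_antimono[OF r, of b s] b s 5 by auto
    moreover have "g1 b * (t - b) \<le> g2 s * (t - b)"
      using 5 gb calculation(3) by (intro mult_right_mono_neg) auto
    ultimately show ?thesis using g2[OF s] 5 by (simp add: algebra_simps)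
  qed
qed

lemma supergrad_on_affine:
  assumes "\<And>s. s \<in> S \<Longrightarrow> f s = (s - c) * m + e"
  shows "supergrad_on S f (\<lambda>_. m)"
  by (auto simp: supergrad_on_def assms algebra_simps)

lemma supergrad_on_deriv2:
  assumes S: "convex S"
    and f: "\<And>x. x \<in> S \<Longrightarrow> (f has_real_derivative g x) (at x)"
    and g: "\<And>x. x \<in> S \<Longrightarrow> (g has_real_derivative h x) (at x)"
    and h: "\<And>x. x \<in> S \<Longrightarrow> h x \<le> 0"
  shows "supergrad_on S f g"
  unfolding supergrad_on_def
proof (intro ballI)
  fix s t assume "s \<in> S" "t \<in> S"
  then have "- g s * (t - s) \<le> - f t - - f s"
    by (intro f''_imp_f'[OF S, where f''="\<lambda>x. - h x"]) (auto intro!: derivative_intros f g simp: h)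
  then show "f t \<le> f s + g s * (t - s)" by simp
qed

section \<open>The special function for exponents above 2\<close>

locale bellman =
  fixes p \<gamma> \<beta> :: real
  assumes p: "2 < p"
  defines "\<gamma> \<equiv> p\<^sup>2 / (2 * (p - 1))" and "\<beta> \<equiv> 1 - 2 / p"
begin

text \<open>Left of the ray the special function is \<open>x * F c\<close> with
  \<open>x = (s - c) / 2\<close>. Continuity determines \<open>F\<close>: for
  \<open>\<beta> \<le> c\<close> by the values \<open>1 - \<gamma> * x\<close> on
  \<open>s = 1\<close>, for smaller \<open>c\<close> by the values on the ray.\<close>

definition F :: "real \<Rightarrow> real" where
  "F c = (if \<beta> \<le> c then 2 / (1 - c) - \<gamma> else \<gamma> * \<beta> powr (2 - p) * c powr (p - 1))"

definition F' :: "real \<Rightarrow> real" where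
  "F' c = (if \<beta> \<le> c then 2 / (1 - c)\<^sup>2 else \<gamma> * \<beta> powr (2 - p) * ((p - 1) * c powr (p - 2)))"

text \<open>The condition \<open>\<beta> s \<le> c\<close> says \<open>y \<ge> (p - 1) x\<close>: the point lies to the left of the ray.
  For \<open>s < 1\<close> and \<open>\<beta> \<le> c\<close> the line of slope 1 meets \<open>s = 1\<close> before the ray.\<close>
definition U :: "real \<Rightarrow> real \<Rightarrow> real" where
  "U s c = (if 1 \<le> s then 1 + p * (s - 1) - p\<^sup>2 / 4 * (s - 1) * (1 - c) - \<gamma> * (s - c) / 2
    else if \<beta> * s \<le> c then (s - c) / 2 * F c
    else s powr p - \<gamma> * (s - c) / 2 * s powr (p - 1))"

text \<open>At \<open>s = 1\<close> the slope from the right is chosen: for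
  \<open>\<beta> < c < 1\<close> there is a concave kink.\<close>

definition Us :: "real \<Rightarrow> real \<Rightarrow> real" where
  "Us s c = (if 1 \<le> s then p - p\<^sup>2 / 4 * (1 - c) - \<gamma> / 2
    else if \<beta> * s \<le> c then F c / 2
    else (p - \<gamma> / 2) * s powr (p - 1) - p\<^sup>2 / 4 * (s - c) * s powr (p - 2))"

definition Uc :: "real \<Rightarrow> real \<Rightarrow> real" where
  "Uc s c = (if 1 \<le> s then p\<^sup>2 / 4 * (s - 1) + \<gamma> / 2
    else if \<beta> * s \<le> c then (s - c) / 2 * F' c - F c / 2
    else \<gamma> / 2 * s powr (p - 1))"

lemma beta: "0 < \<beta>" "\<beta> < 1" and gamma: "0 < \<gamma>" "\<gamma> < p" "2 < \<gamma>" "\<gamma> * (p - 1) = p\<^sup>2 / 2"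
  "p * \<beta> = p - 2"
proof -
  show "0 < \<beta>" "\<beta> < 1" "0 < \<gamma>" "\<gamma> * (p - 1) = p\<^sup>2 / 2" "p * \<beta> = p - 2"
    using p by (auto simp: \<beta>_def \<gamma>_def field_simps)
  have "p * p < p * (2 * (p - 1))" using p by (intro mult_strict_left_mono) auto
  then show "\<gamma> < p" using p by (simp add: \<gamma>_def field_simps power2_eq_square)
  have "0 < (p - 2)\<^sup>2" using p by simp
  then show "2 < \<gamma>" using p by (simp add: \<gamma>_def field_simps power2_eq_square)
qed

lemma gamma_beta: "\<gamma> * \<beta> = p - \<gamma>"
  using p by (simp add: \<gamma>_def \<beta>_def field_simps power2_eq_square)

lemma F_beta: "\<gamma> * \<beta> powr (2 - p) * \<beta> powr (p - 1) = p - \<gamma>"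
  and F'_beta: "\<gamma> * \<beta> powr (2 - p) * ((p - 1) * \<beta> powr (p - 2)) = p\<^sup>2 / 2"
  and F_beta': "2 / (1 - \<beta>) = p"
proof -
  show "\<gamma> * \<beta> powr (2 - p) * \<beta> powr (p - 1) = p - \<gamma>"
    using gamma_beta beta by (simp add: mult.assoc powr_add[symmetric])
  show "\<gamma> * \<beta> powr (2 - p) * ((p - 1) * \<beta> powr (p - 2)) = p\<^sup>2 / 2"
    using gamma(4) beta by (simp add: mult.assoc powr_add[symmetric] mult.left_commute)
  show "2 / (1 - \<beta>) = p" using p by (simp add: \<beta>_def)
qed

text \<open>Left of the ray \<open>F c / 2\<close> is the slope in \<open>s\<close>, so this is the
  sign of the mixed derivative there. The two increasing branches meet at \<open>\<beta>\<close>
  with the common value \<open>p - \<gamma>\<close>.\<close>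

lemma F_mono:
  assumes "0 \<le> c" "c \<le> c'" "c' < 1" shows "F c \<le> F c'"
proof -
  have 1: "F a \<le> F b" if "\<beta> \<le> a" "a \<le> b" "b < 1" for a b
    using that by (auto simp: F_def intro!: divide_left_mono)
  have 2: "F a \<le> \<gamma> * \<beta> powr (2 - p) * b powr (p - 1)" if "0 \<le> a" "a \<le> b" "b \<le> \<beta>" for a b
    using that p gamma F_beta F_beta' by (cases "a = \<beta>") (auto simp: F_def intro!: mult_left_mono powr_mono2)
  show ?thesis
  proof (cases "c' < \<beta>")
    case True then show ?thesis using 2[of c c'] assms by (auto simp: F_def)
  next
    case False
    show ?thesis
    proof (cases "c < \<beta>")
      case True
      have "F c \<le> F \<beta>" using 2[of c \<beta>] True assms F_beta F_beta' by (simp add: F_def)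
      also have "\<dots> \<le> F c'" using 1 False assms by simp
      finally show ?thesis .
    next
      case c: False then show ?thesis using 1 assms by simp
    qed
  qed
qed

lemma F_nonneg: assumes "0 \<le> c" "c < 1" shows "0 \<le> F c"
  using F_mono[of 0 c] assms beta p by (simp add: F_def)

lemma scale_F: assumes "0 < s" shows "\<gamma> * \<beta> powr (2 - p) * (\<beta> * s) powr (p - 1) = (p - \<gamma>) * s powr (p - 1)"
  and scale_F': "\<gamma> * \<beta> powr (2 - p) * ((p - 1) * (\<beta> * s) powr (p - 2)) = p\<^sup>2 / 2 * s powr (p - 2)"
  using assms F_beta F'_beta beta by (simp_all add: powr_mult mult.assoc[symmetric])

lemma powr_eqs: assumes "0 < s" shows "s powr (p - 1) = s * s powr (p - 2)" "s powr p = s * s * s powr (p - 2)"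
  using assms by (simp_all add: powr_diff power2_eq_square)

text \<open>Smooth fit across the ray \<open>c = \<beta> * s\<close>: value, slope in
  \<open>s\<close>, slope in \<open>c\<close>, in this order.\<close>

lemma U_join:
  assumes "0 < s" "s \<le> 1"
  shows "s powr p - \<gamma> * (s - \<beta> * s) / 2 * s powr (p - 1) = (s - \<beta> * s) / 2 * ((p - \<gamma>) * s powr (p - 1))"
    "(p - \<gamma> / 2) * s powr (p - 1) - p\<^sup>2 / 4 * (s - \<beta> * s) * s powr (p - 2) = (p - \<gamma>) * s powr (p - 1) / 2"
    "(s - \<beta> * s) / 2 * (p\<^sup>2 / 2 * s powr (p - 2)) - (p - \<gamma>) * s powr (p - 1) / 2 = \<gamma> / 2 * s powr (p - 1)"
proof -
  have sb: "s - \<beta> * s = 2 * s / p" using p by (simp add: \<beta>_def field_simps)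
  show "s powr p - \<gamma> * (s - \<beta> * s) / 2 * s powr (p - 1) = (s - \<beta> * s) / 2 * ((p - \<gamma>) * s powr (p - 1))"
    unfolding sb powr_eqs[OF assms(1)] using p by (simp add: field_simps power2_eq_square)
  show "(p - \<gamma> / 2) * s powr (p - 1) - p\<^sup>2 / 4 * (s - \<beta> * s) * s powr (p - 2) = (p - \<gamma>) * s powr (p - 1) / 2"
    unfolding sb powr_eqs[OF assms(1)] using p by (simp add: field_simps power2_eq_square)
  show "(s - \<beta> * s) / 2 * (p\<^sup>2 / 2 * s powr (p - 2)) - (p - \<gamma>) * s powr (p - 1) / 2 = \<gamma> / 2 * s powr (p - 1)"
    unfolding sb powr_eqs[OF assms(1)] using p by (simp add: field_simps power2_eq_square)
qed


section \<open>Concavity in \<open>s\<close> and in \<open>c\<close>, and the tangent plane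
  inequality\<close>

lemma U_linear_right: "supergrad_on {1..} (\<lambda>s. U s c) (\<lambda>s. Us s c)"
  by (auto simp: supergrad_on_def U_def Us_def field_simps)

text \<open>The second derivative in \<open>s\<close> is a positive multiple of
  \<open>p * c - (p - 2) * s\<close>, so concavity holds precisely up to the ray.\<close>

lemma power_part_concave:
  assumes T: "convex T" "T \<subseteq> {0<..}" "\<And>s. s \<in> T \<Longrightarrow> p * c \<le> (p - 2) * s"
  shows "supergrad_on T (\<lambda>s. s powr p - \<gamma> * (s - c) / 2 * s powr (p - 1))
    (\<lambda>s. (p - \<gamma> / 2) * s powr (p - 1) - p\<^sup>2 / 4 * (s - c) * s powr (p - 2))"
proof (rule supergrad_on_deriv2[where
      h="\<lambda>s. (p - 2) * p / 4 * s powr (p - 3) * (p * c - (p - 2) * s)"])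
  fix s assume s: "s \<in> T"
  then have s0: "0 < s" using T by auto
  have e: "s powr (p - 1) = s * s * s powr (p - 3)" "s powr (p - 2) = s * s powr (p - 3)"
    "s powr p = s * s * s * s powr (p - 3)"
    using s0 by (simp_all add: powr_diff power2_eq_square power3_eq_cube)
  have g: "\<gamma> * p = \<gamma> + p * p / 2" using gamma(4) by (simp add: algebra_simps power2_eq_square)
  show "((\<lambda>s. s powr p - \<gamma> * (s - c) / 2 * s powr (p - 1)) has_real_derivative
      (p - \<gamma> / 2) * s powr (p - 1) - p\<^sup>2 / 4 * (s - c) * s powr (p - 2)) (at s)"
  proof (rule DERIV_cong)
    show "((\<lambda>s. s powr p - \<gamma> * (s - c) / 2 * s powr (p - 1)) has_real_derivative
      p * s powr (p - 1) - (\<gamma> / 2 * s powr (p - 1) + \<gamma> * (s - c) / 2 * ((p - 1) * s powr (p - 2)))) (at s)"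
      by (auto intro!: derivative_eq_intros simp: s0 diff_diff_eq field_simps)
    have "p * s powr (p - 1) - (\<gamma> / 2 * s powr (p - 1) + \<gamma> * (s - c) / 2 * ((p - 1) * s powr (p - 2)))
       = (p - \<gamma> / 2) * s powr (p - 1) - (\<gamma> * (p - 1)) / 2 * (s - c) * s powr (p - 2)"
      by (simp add: field_simps)
    then show "p * s powr (p - 1) - (\<gamma> / 2 * s powr (p - 1) + \<gamma> * (s - c) / 2 * ((p - 1) * s powr (p - 2)))
       = (p - \<gamma> / 2) * s powr (p - 1) - p\<^sup>2 / 4 * (s - c) * s powr (p - 2)"
      unfolding gamma(4) by simp
  qed
  show "((\<lambda>s. (p - \<gamma> / 2) * s powr (p - 1) - p\<^sup>2 / 4 * (s - c) * s powr (p - 2)) has_real_derivative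
      (p - 2) * p / 4 * s powr (p - 3) * (p * c - (p - 2) * s)) (at s)"
  proof (rule DERIV_cong)
    show "((\<lambda>s. (p - \<gamma> / 2) * s powr (p - 1) - p\<^sup>2 / 4 * (s - c) * s powr (p - 2)) has_real_derivative
      (p - \<gamma> / 2) * ((p - 1) * s powr (p - 2)) - (p\<^sup>2 / 4 * s powr (p - 2)
        + p\<^sup>2 / 4 * (s - c) * ((p - 2) * s powr (p - 3)))) (at s)"
      by (auto intro!: derivative_eq_intros simp: s0 diff_diff_eq field_simps)
    have "(p - \<gamma> / 2) * (p - 1) = p * (p - 1) - p\<^sup>2 / 4" using gamma(4) by (simp add: algebra_simps)
    then have "(p - \<gamma> / 2) * ((p - 1) * s powr (p - 2)) = (p * (p - 1) - p\<^sup>2 / 4) * s powr (p - 2)"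
      by (metis mult.assoc)
    then show "(p - \<gamma> / 2) * ((p - 1) * s powr (p - 2)) - (p\<^sup>2 / 4 * s powr (p - 2)
        + p\<^sup>2 / 4 * (s - c) * ((p - 2) * s powr (p - 3)))
      = (p - 2) * p / 4 * s powr (p - 3) * (p * c - (p - 2) * s)"
      unfolding e by (simp add: field_simps power2_eq_square)
  qed
  show "(p - 2) * p / 4 * s powr (p - 3) * (p * c - (p - 2) * s) \<le> 0"
    using p T(3)[OF s] by (intro mult_nonneg_nonpos) auto
qed (rule T)

lemma U_concave_s: "supergrad_on {s. 0 < s \<and> c < s} (\<lambda>s. U s c) (\<lambda>s. Us s c)" (is "supergrad_on ?S _ _")
proof (cases "1 \<le> c")
  case True
  then show ?thesis using U_linear_right[of c] by (auto simp: supergrad_on_def)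
next
  case c1: False
  have right: "supergrad_on (?S \<inter> {1..}) (\<lambda>s. U s c) (\<lambda>s. Us s c)"
    using U_linear_right[of c] by (auto simp: supergrad_on_def)
  let ?g4 = "\<lambda>s. (p - \<gamma> / 2) * s powr (p - 1) - p\<^sup>2 / 4 * (s - c) * s powr (p - 2)"
  let ?f4 = "\<lambda>s. s powr p - \<gamma> * (s - c) / 2 * s powr (p - 1)"
  show ?thesis
  proof (cases "\<beta> \<le> c")
    case True
    have bs: "\<beta> * s \<le> c" if "s \<le> 1" for s
    proof -
      have "\<beta> * s \<le> \<beta> * 1" using that beta by (intro mult_left_mono) auto
      then show ?thesis using True by simp
    qed
    have U1: "U 1 c = (1 - c) / 2 * F c" using True c1 by (simp add: U_def F_def field_simps)
    have Us1: "Us 1 c \<le> F c / 2"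
    proof -
      \<comment> \<open>The slope drop at \<open>s = 1\<close> is a square over
        \<open>1 - c\<close>; it vanishes only at \<open>c = \<beta>\<close>.\<close>
      have "0 \<le> (p * (1 - c) / 2 - 1)\<^sup>2 / (1 - c)" using c1 by simp
      also have "\<dots> = 1 / (1 - c) - (p - p\<^sup>2 / 4 * (1 - c))" using c1
        by (simp add: field_simps power2_eq_square)
      finally have "p - p\<^sup>2 / 4 * (1 - c) \<le> 1 / (1 - c)" by simp
      moreover have "F c / 2 = 1 / (1 - c) - \<gamma> / 2" using True by (simp add: F_def field_simps)
      moreover have "Us 1 c = p - p\<^sup>2 / 4 * (1 - c) - \<gamma> / 2" by (simp add: Us_def)
      ultimately show ?thesis by linarith
    qed
    show ?thesis
    proof (rule supergrad_on_glue[where b=1 and ?g1.0="\<lambda>_. F c / 2", OF _ right])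
      have "U s c = (s - c) * (F c / 2) + 0" if "s \<in> ?S \<inter> {..1}" for s
        using that bs[of s] U1 by (cases "s = 1") (auto simp: U_def)
      then show "supergrad_on (?S \<inter> {..1}) (\<lambda>s. U s c) (\<lambda>_. F c / 2)"
        by (rule supergrad_on_affine)
    qed (use c1 bs Us1 in \<open>auto simp: Us_def\<close>)
  next
    case cb: False
    have U1: "U 1 c = ?f4 1" by (simp add: U_def)
    \<comment> \<open>At \<open>s = 1\<close> the slope \<open>Us\<close> already uses the outer
      formula, so the left piece gets the power formula there; the final gluing checks that they
      agree.\<close>
    have left: "supergrad_on (?S \<inter> {..1}) (\<lambda>s. U s c) (\<lambda>s. if s = 1 then ?g4 1 else Us s c)"
    proof (cases "c \<le> 0")
      case True
      have n: "\<not> \<beta> * s \<le> c" if "0 < s" for s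
      proof -
        have "0 < \<beta> * s" using that beta by simp
        then show ?thesis using True by linarith
      qed
      have "supergrad_on (?S \<inter> {..1}) ?f4 ?g4"
      proof (rule power_part_concave)
        show "convex (?S \<inter> {..1})" by (auto simp: convex_real_interval intro: is_interval_convex simp: is_interval_1)
        fix s assume "s \<in> ?S \<inter> {..1}"
        then have "p * c \<le> 0" "0 \<le> (p - 2) * s" using p True by (auto intro: mult_nonneg_nonpos)
        then show "p * c \<le> (p - 2) * s" by linarith
      qed auto
      then show ?thesis
        by (subst supergrad_on_cong[where f'="?f4" and g'="?g4"]) (use n in \<open>auto simp: U_def Us_def\<close>)
    next
      case False
      \<comment> \<open>The line of constant \<open>c\<close> crosses the ray at
        \<open>s = b\<close>.\<close>
      define b where "b = c / \<beta>"
      have b: "0 < b" "b < 1" "c < b" "\<beta> * b = c"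
        using False cb beta mult_strict_left_mono[of \<beta> 1 c] by (auto simp: b_def field_simps)
      have lt: "\<beta> * s \<le> c \<longleftrightarrow> s \<le> b" for s using beta by (simp add: b_def field_simps)
      have Fc: "F c = (p - \<gamma>) * b powr (p - 1)" using scale_F[of b] b cb by (simp add: F_def)
      have Ub: "U b c = ?f4 b" and gb: "?g4 b = F c / 2"
        using U_join[of b] b Fc lt[of b] by (auto simp: U_def)
      show ?thesis
      proof (rule supergrad_on_glue[where b=b and ?g1.0="\<lambda>_. F c / 2" and ?g2.0="?g4"])
        have "U s c = (s - c) * (F c / 2) + 0" if "s \<in> ?S \<inter> {..1} \<inter> {..b}" for s
          using that b lt[of s] by (auto simp: U_def)
        then show "supergrad_on (?S \<inter> {..1} \<inter> {..b}) (\<lambda>s. U s c) (\<lambda>_. F c / 2)"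
          by (rule supergrad_on_affine)
        have "supergrad_on (?S \<inter> {..1} \<inter> {b..}) ?f4 ?g4"
        proof (rule power_part_concave)
          show "convex (?S \<inter> {..1} \<inter> {b..})" by (auto intro: is_interval_convex simp: is_interval_1)
          fix s assume "s \<in> ?S \<inter> {..1} \<inter> {b..}"
          then have "c \<le> \<beta> * s" using beta by (auto simp: b_def field_simps)
          then have "p * c \<le> p * (\<beta> * s)" using p by (intro mult_left_mono) auto
          then show "p * c \<le> (p - 2) * s" using gamma(5) by (simp add: mult.assoc[symmetric])
        qed auto
        moreover have "U s c = ?f4 s" if "s \<in> ?S \<inter> {..1} \<inter> {b..}" for s
          using that Ub U1 lt[of s] by (cases "s = b"; cases "s = 1") (auto simp: U_def)
        ultimately show "supergrad_on (?S \<inter> {..1} \<inter> {b..}) (\<lambda>s. U s c) ?g4"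
          by (simp add: supergrad_on_def)
      qed (use b lt gb in \<open>auto simp: Us_def\<close>)
    qed
    show ?thesis
    proof (rule supergrad_on_glue[OF left right])
      show "Us 1 c \<le> (if (1::real) = 1 then ?g4 1 else Us 1 c)" by (simp add: Us_def algebra_simps)
    qed (use c1 in auto)
  qed
qed

text \<open>Affine in \<open>c\<close> to the right of the ray. To the left, for \<open>c\<close>
  below \<open>\<beta>\<close>, the second derivative has the sign of
  \<open>(p - 2) * s - p * c\<close>, nonpositive exactly on the side complementary to
  \<open>power_part_concave\<close>.\<close>

lemma U_concave_c:
  assumes s: "0 < s" shows "supergrad_on {..<s} (U s) (Uc s)"
proof (cases "1 \<le> s")
  case True then show ?thesis by (auto simp: supergrad_on_def U_def Uc_def field_simps)
next
  case s1: False
  let ?\<kappa> = "\<gamma> * \<beta> powr (2 - p)"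
  let ?f3 = "\<lambda>c. (s - c) / 2 * (?\<kappa> * c powr (p - 1))"
  let ?g3 = "\<lambda>c. (s - c) / 2 * (?\<kappa> * ((p - 1) * c powr (p - 2))) - ?\<kappa> * c powr (p - 1) / 2"
  let ?f2 = "\<lambda>c. (s - c) / 2 * (2 / (1 - c) - \<gamma>)"
  let ?g2 = "\<lambda>c. (s - c) / 2 * (2 / (1 - c)\<^sup>2) - (2 / (1 - c) - \<gamma>) / 2"
  have bs: "0 < \<beta> * s" "\<beta> * s < \<beta>" "\<beta> * s < s" using s s1 beta mult_strict_left_mono[of s 1 \<beta>] by auto
  have k: "0 \<le> ?\<kappa>" using gamma by simp
  have three: "supergrad_on T ?f3 ?g3"
    if T: "convex T" "T \<subseteq> {\<beta> * s..}" for T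
  proof (rule supergrad_on_deriv2[where h="\<lambda>c. ?\<kappa> * (p - 1) * c powr (p - 3) * ((s - c) / 2 * (p - 2) - c)"])
    fix c assume "c \<in> T"
    then have c: "\<beta> * s \<le> c" "0 < c" using T bs by force+
    have e: "c powr (p - 2) = c * c powr (p - 3)" using c by (simp add: powr_diff power2_eq_square power3_eq_cube)
    show "(?f3 has_real_derivative ?g3 c) (at c)"
      by (auto intro!: derivative_eq_intros simp: c diff_diff_eq field_simps)
    show "(?g3 has_real_derivative ?\<kappa> * (p - 1) * c powr (p - 3) * ((s - c) / 2 * (p - 2) - c)) (at c)"
    proof (rule DERIV_cong)
      show "(?g3 has_real_derivative (s - c) / 2 * (?\<kappa> * ((p - 1) * ((p - 2) * c powr (p - 3))))
        - (?\<kappa> * ((p - 1) * c powr (p - 2))) / 2 - ?\<kappa> * ((p - 1) * c powr (p - 2)) / 2) (at c)"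
        by (auto intro!: derivative_eq_intros simp: c diff_diff_eq field_simps)
    qed (simp add: e field_simps)
    have "p * (\<beta> * s) \<le> p * c" using c p by (intro mult_left_mono) auto
    then have "(p - 2) * s \<le> p * c" using gamma(5) by (simp add: mult.assoc[symmetric])
    then have "(s - c) / 2 * (p - 2) - c \<le> 0" by (simp add: field_simps)
    then show "?\<kappa> * (p - 1) * c powr (p - 3) * ((s - c) / 2 * (p - 2) - c) \<le> 0"
      using k p by (intro mult_nonneg_nonpos) auto
  qed (rule T)
  \<comment> \<open>Since \<open>(s - c) / (1 - c) = 1 - (1 - s) / (1 - c)\<close>, concavity comes
    from \<open>s < 1\<close>; the defect in the tangent inequality is a square over positive
    factors.\<close>
  have two: "supergrad_on {..<1} ?f2 ?g2"
  proof -
    have "supergrad_on {..<1} (\<lambda>c. 1 - (1 - s) / (1 - c) - \<gamma> * (s - c) / 2) (\<lambda>c. \<gamma> / 2 - (1 - s) / (1 - c)\<^sup>2)"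
      unfolding supergrad_on_def
    proof (intro ballI)
      fix c t :: real assume ct: "c \<in> {..<1}" "t \<in> {..<1}"
      have "0 \<le> (1 - s) * ((t - c)\<^sup>2 / ((1 - c)\<^sup>2 * (1 - t)))" using ct s1 by auto
      also have "(t - c)\<^sup>2 / ((1 - c)\<^sup>2 * (1 - t)) = 1 / (1 - t) - 1 / (1 - c) - (t - c) / (1 - c)\<^sup>2"
      proof -
        have "1 / v - 1 / u - (u - v) / u\<^sup>2 = (u - v)\<^sup>2 / (u\<^sup>2 * v)" if "0 < u" "0 < v" for u v :: real
          using that by (simp add: divide_simps) (simp add: algebra_simps power2_eq_square)
        from this[of "1 - c" "1 - t"] ct show ?thesis by simp
      qed
      finally show "1 - (1 - s) / (1 - t) - \<gamma> * (s - t) / 2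
          \<le> 1 - (1 - s) / (1 - c) - \<gamma> * (s - c) / 2 + (\<gamma> / 2 - (1 - s) / (1 - c)\<^sup>2) * (t - c)"
        by (simp add: algebra_simps diff_divide_distrib add_divide_distrib)
    qed
    moreover have "1 - (1 - s) / (1 - c) - \<gamma> * (s - c) / 2 = ?f2 c" "\<gamma> / 2 - (1 - s) / (1 - c)\<^sup>2 = ?g2 c"
      if "c \<in> {..<1}" for c
    proof -
      have "1 - (1 - s) / u - \<gamma> * (s - (1 - u)) / 2 = (s - (1 - u)) / 2 * (2 / u - \<gamma>)"
        "\<gamma> / 2 - (1 - s) / u\<^sup>2 = (s - (1 - u)) / 2 * (2 / u\<^sup>2) - (2 / u - \<gamma>) / 2" if "0 < u" for u
        using that by (simp_all add: divide_simps) (simp_all add: algebra_simps power2_eq_square)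
      from this[of "1 - c"] that show "1 - (1 - s) / (1 - c) - \<gamma> * (s - c) / 2 = ?f2 c" "\<gamma> / 2 - (1 - s) / (1 - c)\<^sup>2 = ?g2 c"
        by simp_all
    qed
    ultimately show ?thesis by (simp add: supergrad_on_def)
  qed
  have mid: "supergrad_on ({..<s} \<inter> {\<beta> * s..}) (\<lambda>c. (s - c) / 2 * F c) (\<lambda>c. (s - c) / 2 * F' c - F c / 2)"
  proof (cases "\<beta> < s")
    case True
    show ?thesis
    proof (rule supergrad_on_glue[where b=\<beta> and ?g1.0="?g3" and ?g2.0="?g2"])
      have "supergrad_on ({..<s} \<inter> {\<beta> * s..} \<inter> {..\<beta>}) ?f3 ?g3"
        by (rule three) (auto intro: is_interval_convex simp: is_interval_1)
      moreover have "F c = ?\<kappa> * c powr (p - 1)" if "c \<le> \<beta>" for c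
        using that F_beta F_beta' by (auto simp: F_def)
      ultimately show "supergrad_on ({..<s} \<inter> {\<beta> * s..} \<inter> {..\<beta>}) (\<lambda>c. (s - c) / 2 * F c) ?g3"
        by (auto simp: supergrad_on_def)
      show "supergrad_on ({..<s} \<inter> {\<beta> * s..} \<inter> {\<beta>..}) (\<lambda>c. (s - c) / 2 * F c) ?g2"
        using two s1 by (auto simp: supergrad_on_def F_def)
      have "2 / (1 - \<beta>)\<^sup>2 = p\<^sup>2 / 2" using p by (simp add: \<beta>_def power_divide)
      then have "?g2 \<beta> = ?g3 \<beta>" by (simp only: F_beta F'_beta F_beta')
      moreover have "(s - \<beta>) / 2 * F' \<beta> - F \<beta> / 2 = ?g2 \<beta>" by (simp add: F_def F'_def)
      ultimately show "?g2 \<beta> \<le> (s - \<beta>) / 2 * F' \<beta> - F \<beta> / 2" "(s - \<beta>) / 2 * F' \<beta> - F \<beta> / 2 \<le> ?g3 \<beta>"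
        by simp_all
    qed (use bs True s1 in \<open>auto simp: F_def F'_def\<close>)
  next
    case False
    have "supergrad_on ({..<s} \<inter> {\<beta> * s..}) ?f3 ?g3"
      by (rule three) (auto intro: is_interval_convex simp: is_interval_1)
    then show ?thesis
      by (subst supergrad_on_cong[where f'="?f3" and g'="?g3"]) (use False in \<open>auto simp: F_def F'_def\<close>)
  qed
  let ?h1 = "\<lambda>c::real. \<gamma> / 2 * s powr (p - 1)"
  have Fb: "F (\<beta> * s) = (p - \<gamma>) * s powr (p - 1)" using scale_F[OF s] bs s1 by (simp add: F_def)
  have F'b: "F' (\<beta> * s) = p\<^sup>2 / 2 * s powr (p - 2)" using scale_F'[OF s] bs s1 by (simp add: F'_def)
  have Ub: "U s (\<beta> * s) = s powr p - \<gamma> * (s - \<beta> * s) / 2 * s powr (p - 1)"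
    using U_join(1)[of s] s s1 Fb by (simp_all add: U_def)
  have "Uc s (\<beta> * s) = (s - \<beta> * s) / 2 * (p\<^sup>2 / 2 * s powr (p - 2)) - (p - \<gamma>) * s powr (p - 1) / 2"
    using s1 by (simp only: Uc_def Fb F'b) simp
  then have gb: "Uc s (\<beta> * s) = \<gamma> / 2 * s powr (p - 1)"
    using U_join(3)[of s] s s1 by linarith
  show ?thesis
  proof (rule supergrad_on_glue[where b="\<beta> * s" and ?g1.0="?h1" and ?g2.0="\<lambda>c. (s - c) / 2 * F' c - F c / 2"])
    have "U s c = (c - s) * (\<gamma> / 2 * s powr (p - 1)) + s powr p" if "c \<in> {..<s} \<inter> {..\<beta> * s}" for c
    proof -
      have "U s c = s powr p - \<gamma> * (s - c) / 2 * s powr (p - 1)"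
        using that Ub s1 by (cases "c = \<beta> * s") (auto simp: U_def)
      then show ?thesis by (simp add: field_simps)
    qed
    then show "supergrad_on ({..<s} \<inter> {..\<beta> * s}) (U s) ?h1"
      by (rule supergrad_on_affine)
    show "supergrad_on ({..<s} \<inter> {\<beta> * s..}) (U s) (\<lambda>c. (s - c) / 2 * F' c - F c / 2)"
      using mid s1 by (auto simp: supergrad_on_def U_def)
  qed (use bs s1 gb in \<open>auto simp: Uc_def\<close>)
qed

lemma Us_mono_c:
  assumes s: "0 < s" and c: "c \<le> c'" "c' < s"
  shows "Us s c \<le> Us s c'"
proof (cases "1 \<le> s")
  case True
  have "p\<^sup>2 / 4 * (1 - c') \<le> p\<^sup>2 / 4 * (1 - c)" using c by (intro mult_left_mono) auto
  then show ?thesis using True by (simp add: Us_def)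
next
  case s1: False
  have bs: "0 < \<beta> * s" "\<beta> * s < \<beta>" "\<beta> * s < s" using s s1 beta mult_strict_left_mono[of s 1 \<beta>] by auto
  let ?g4 = "\<lambda>c. (p - \<gamma> / 2) * s powr (p - 1) - p\<^sup>2 / 4 * (s - c) * s powr (p - 2)"
  have 4: "?g4 a \<le> ?g4 b" if "a \<le> b" for a b
    using that by (auto intro!: mult_right_mono mult_left_mono)
  have Fb: "F (\<beta> * s) / 2 = ?g4 (\<beta> * s)" using scale_F(1)[OF s] U_join(2)[of s] s s1 bs by (simp add: F_def)
  consider "c' < \<beta> * s" | "\<beta> * s \<le> c" | "c < \<beta> * s" "\<beta> * s \<le> c'" by linarith
  then show ?thesis
  proof cases
    case 1 then show ?thesis using 4[of c c'] c s1 by (simp add: Us_def)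
  next
    case 2 then show ?thesis using F_mono[of c c'] c s1 bs by (simp add: Us_def)
  next
    case 3
    have "?g4 c \<le> F (\<beta> * s) / 2" using 4[of c "\<beta> * s"] 3 Fb by linarith
    also have "\<dots> \<le> F c' / 2" using F_mono[of "\<beta> * s" c'] 3 c s1 bs by simp
    finally show ?thesis using 3 s1 by (simp add: Us_def)
  qed
qed

text \<open>The move passes through the corner \<open>(s, c')\<close>: first \<open>c\<close> at
  fixed \<open>s\<close>, then \<open>s\<close> at fixed \<open>c'\<close>. The second part costs
  the slope \<open>Us s c'\<close> instead of \<open>Us s c\<close>; by \<open>Us_mono_c\<close> and
  the opposite signs of the increments this exchange goes the right way.\<close>

lemma U_tangent:
  assumes P: "0 < s" "c < s" and Z: "0 < s'" "c' < s'"
    and cone: "(s' - s) * (c' - c) \<le> 0"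
  shows "U s' c' \<le> U s c + Us s c * (s' - s) + Uc s c * (c' - c)"
proof -
  \<comment> \<open>The corner stays in the domain: \<open>c' \<ge> s\<close> would mean that
    \<open>c\<close> increases, hence \<open>s' \<le> s \<le> c'\<close>.\<close>
  have c's: "c' < s" using cone P Z by (smt (verit) mult_neg_neg zero_less_mult_iff)
  have "U s' c' \<le> U s c' + Us s c' * (s' - s)"
    using supergrad_onD[OF U_concave_s[of c'], of s s'] P Z c's by simp
  moreover have "U s c' \<le> U s c + Uc s c * (c' - c)"
    using supergrad_onD[OF U_concave_c[of s], of c c'] P c's by simp
  moreover have "Us s c' * (s' - s) \<le> Us s c * (s' - s)"
  proof (cases "c \<le> c'")
    case True
    show ?thesis
    proof (cases "c = c'")
      case False
      then have "s' - s \<le> 0" using cone True by (smt (verit) mult_pos_pos)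
      then show ?thesis using Us_mono_c[of s c c'] P c's True by (intro mult_right_mono_neg) auto
    qed simp
  next
    case False
    then have "0 \<le> s' - s" using cone by (smt (verit) mult_neg_neg)
    then show ?thesis using Us_mono_c[of s c' c] P False by (intro mult_right_mono) auto
  qed
  ultimately show ?thesis by linarith
qed

section \<open>Majorization, sign at the start, and slope on the axis\<close>

definition K :: real where "K = (p / 2) powr p / (p - 1)"

text \<open>For fixed \<open>t\<close> the left side is the tangent line of the convex function
  \<open>K * x powr p\<close> at \<open>x = 2 * t / p\<close>, the point to which the extremal
  process jumps.\<close>

lemma young:
  assumes "0 \<le> x" "0 < t" shows "\<gamma> * x * t powr (p - 1) - t powr p \<le> K * x powr p"
proof -
  have "t powr p + p * t powr (p - 1) * (p / 2 * x - t) \<le> (p / 2 * x) powr p"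
    using assms p by (intro powr_ge_tangent_at) auto
  also have "\<dots> = (p / 2) powr p * x powr p" by (rule powr_mult)
  also have "\<dots> = (p - 1) * (K * x powr p)" using p by (simp add: K_def)
  also have "t powr p + p * t powr (p - 1) * (p / 2 * x - t) = (p - 1) * (\<gamma> * x * t powr (p - 1) - t powr p)"
  proof -
    have "p * t powr (p - 1) * (p / 2 * x - t) = p\<^sup>2 / 2 * x * t powr (p - 1) - p * (t powr (p - 1) * t)"
      by (simp add: algebra_simps power2_eq_square)
    also have "t powr (p - 1) * t = t powr p" using assms by (simp add: powr_diff)
    finally show ?thesis unfolding gamma(4)[symmetric] by (simp add: algebra_simps)
  qed
  finally show ?thesis using p by simp
qed

lemma U_ge:
  assumes x: "0 < x" and w: "0 \<le> w" "w < 1"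
  shows "- (K * x powr p) \<le> U (x + w) (w - x)"
proof -
  define s where "s = x + w"
  have s: "0 < s" "w - x = s - 2 * x" using x w by (auto simp: s_def)
  have K: "0 \<le> K * x powr p" using p by (simp add: K_def)
  consider "1 \<le> s" | "s < 1" "\<beta> * s \<le> w - x" | "s < 1" "w - x < \<beta> * s" by linarith
  then have "- (K * x powr p) \<le> U s (w - x)"
  proof cases
    case 1
    \<comment> \<open>\<open>t powr (p - 1)\<close> is made to match the coefficient of
      \<open>\<gamma> * x\<close> in the bilinear formula. Then \<open>t powr p\<close> has to stay
      below the square in that formula, which is Bernoulli's inequality for the exponent
      \<open>p / (2 * (p - 1)) \<le> 1\<close>.\<close>
    define t where "t = (1 + (p - 1) * (s - 1)) powr (1 / (p - 1))"
    have b: "1 \<le> 1 + (p - 1) * (s - 1)" using 1 p by simp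
    have t: "0 < t" "t powr (p - 1) = 1 + (p - 1) * (s - 1)" using b p by (auto simp: t_def powr_powr)
    have "t powr p = (1 + (p - 1) * (s - 1)) powr (p / (p - 1))" by (simp add: t_def powr_powr)
    also have "p / (p - 1) = p / (2 * (p - 1)) + p / (2 * (p - 1))"
      using field_sum_of_halves[of "p / (p - 1)"] by (simp add: mult.commute)
    also have "(1 + (p - 1) * (s - 1)) powr \<dots> = ((1 + (p - 1) * (s - 1)) powr (p / (2 * (p - 1))))\<^sup>2"
      by (simp only: powr_add power2_eq_square)
    also have "\<dots> \<le> (1 + p / (2 * (p - 1)) * ((p - 1) * (s - 1)))\<^sup>2"
      using p 1 by (intro power_mono one_plus_powr_le mult_nonneg_nonneg) auto
    also have "p / (2 * (p - 1)) * ((p - 1) * (s - 1)) = p * (s - 1) / 2" using p by (simp add: field_simps)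
    finally have tp: "t powr p \<le> (1 + p * (s - 1) / 2)\<^sup>2" .
    have "\<gamma> * x * (1 + (p - 1) * (s - 1)) = \<gamma> * x + (\<gamma> * (p - 1)) * x * (s - 1)" by (simp add: algebra_simps)
    then have "\<gamma> * x + p\<^sup>2 / 2 * x * (s - 1) - (1 + p * (s - 1) / 2)\<^sup>2 \<le> K * x powr p"
      using young[of x t] x t tp unfolding gamma(4) by simp
    moreover have "U s (w - x) = (1 + p * (s - 1) / 2)\<^sup>2 - (\<gamma> * x + p\<^sup>2 / 2 * x * (s - 1))"
      using 1 by (simp add: U_def s(2)) (simp add: field_simps power2_eq_square)
    ultimately show ?thesis by linarith
  next
    case 2
    have "0 \<le> w - x" using 2 s beta by (smt (verit) mult_pos_pos)
    then have "0 \<le> F (w - x)" using x w by (intro F_nonneg) auto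
    then have "0 \<le> U s (w - x)" using 2 x by (auto simp: U_def s(2))
    then show ?thesis using K by linarith
  next
    case 3
    then have "U s (w - x) = s powr p - \<gamma> * x * s powr (p - 1)" by (simp add: U_def s(2))
    then show ?thesis using young[of x s] x s(1) by simp
  qed
  then show ?thesis by (simp add: s_def)
qed

text \<open>For \<open>w = 1\<close> this is a tangent line bound for the power
  \<open>p - 1\<close>, multiplied by \<open>p / 2 * x\<close>, with contact at
  \<open>x = 2 / p\<close>; a larger \<open>w\<close> adds only
  \<open>p * (w - 1) + p^2 / 4 * (w - 1)^2\<close>.\<close>

lemma U_ge_outside:
  assumes x: "0 < x" and w: "1 \<le> w"
  shows "1 - K * x powr p \<le> U (x + w) (w - x)"
proof -
  have "1 + (p - 1) * (p / 2 * x - 1) \<le> (p / 2 * x) powr (p - 1)"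
    using x p by (intro powr_ge_tangent) auto
  then have "(1 + (p - 1) * (p / 2 * x - 1)) * (p / 2 * x) \<le> (p / 2 * x) powr (p - 1) * (p / 2 * x)"
    using x p by (intro mult_right_mono) auto
  also have "\<dots> = (p / 2 * x) powr p" using x p by (simp add: powr_diff)
  also have "\<dots> = (p / 2) powr p * x powr p" by (rule powr_mult)
  also have "\<dots> = (p - 1) * (K * x powr p)" using p by (simp add: K_def)
  also have "(1 + (p - 1) * (p / 2 * x - 1)) * (p / 2 * x) = (p - 1) * (\<gamma> * x - p * x + p\<^sup>2 / 4 * x\<^sup>2)"
  proof -
    have "(p - 1) * (\<gamma> * x) = p\<^sup>2 / 2 * x" using gamma(4) by (simp add: mult_ac)
    then show ?thesis by (simp add: field_simps power2_eq_square)
  qed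
  finally have 1: "\<gamma> * x - p * x + p\<^sup>2 / 4 * x\<^sup>2 \<le> K * x powr p" using p by simp
  have "0 \<le> p * (w - 1)" "0 \<le> p\<^sup>2 / 4 * (w - 1)\<^sup>2" using p w by auto
  moreover have "U (x + w) (w - x) = 1 + p * x + p * (w - 1) - p\<^sup>2 / 4 * x\<^sup>2 + p\<^sup>2 / 4 * (w - 1)\<^sup>2 - \<gamma> * x"
    using x w by (simp add: U_def) (simp add: field_simps power2_eq_square)
  ultimately show ?thesis using 1 by linarith
qed

text \<open>\<open>c \<le> 0\<close> means \<open>\<bar>y\<bar> \<le> x\<close>, which subordination
  at time 0 guarantees for the starting point.\<close>

lemma U_nonpos:
  assumes s: "0 < s" "c \<le> 0" shows "U s c \<le> 0"
proof (cases "1 \<le> s")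
  case True
  have "U s c = U s 0 + (p\<^sup>2 / 4 * (s - 1) + \<gamma> / 2) * c"
    using True by (simp add: U_def field_simps)
  moreover have "(p\<^sup>2 / 4 * (s - 1) + \<gamma> / 2) * c \<le> 0"
    using True s gamma by (intro mult_nonneg_nonpos) auto
  moreover have "U s 0 = (1 - \<gamma> / 2) * s - (p / 2 - 1)\<^sup>2 * (s - 1)"
    using True by (simp add: U_def field_simps power2_eq_square)
  moreover have "(1 - \<gamma> / 2) * s \<le> 0" "0 \<le> (p / 2 - 1)\<^sup>2 * (s - 1)" using gamma True by (auto intro: mult_nonpos_nonneg)
  ultimately show ?thesis by linarith
next
  case False
  have "0 < \<beta> * s" using s beta by simp
  then have "U s c = s powr p - \<gamma> * (s - c) / 2 * s powr (p - 1)" using False s by (simp add: U_def)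
  also have "s powr p = s * s powr (p - 1)" using s by (simp add: powr_diff)
  also have "s * s powr (p - 1) - \<gamma> * (s - c) / 2 * s powr (p - 1) = s powr (p - 1) * ((1 - \<gamma> / 2) * s + \<gamma> / 2 * c)"
    by (simp add: field_simps)
  also have "\<dots> \<le> 0"
    using gamma s by (intro mult_nonneg_nonpos add_nonpos_nonpos mult_nonpos_nonneg) (auto intro: mult_nonneg_nonpos)
  finally show ?thesis .
qed

text \<open>The points \<open>c = - s\<close> form the axis \<open>y = 0\<close>, and the sum is the
  one-sided derivative in \<open>\<bar>y\<bar>\<close>; its sign decides the kink after even
  reflection in \<open>y\<close>.\<close>

lemma gradient_axis:
  assumes s: "0 < s" shows "Us s (- s) + Uc s (- s) \<le> 0"
proof -
  have n: "\<not> \<beta> * s \<le> - s" using s beta by (smt (verit) mult_pos_pos)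
  have pp: "p \<le> p\<^sup>2 / 2" using p by (simp add: power2_eq_square)
  show ?thesis
  proof (cases "1 \<le> s")
    case True
    then have "Us s (- s) + Uc s (- s) = p - p\<^sup>2 / 2" by (simp add: Us_def Uc_def field_simps)
    then show ?thesis using pp by simp
  next
    case False
    then have "Us s (- s) + Uc s (- s) = p * s powr (p - 1) - p\<^sup>2 / 2 * (s * s powr (p - 2))"
      using n by (simp add: Us_def Uc_def field_simps)
    also have "s * s powr (p - 2) = s powr (p - 1)" using s by (simp add: powr_diff power2_eq_square)
    also have "p * s powr (p - 1) - p\<^sup>2 / 2 * s powr (p - 1) = (p - p\<^sup>2 / 2) * s powr (p - 1)"
      by (simp add: algebra_simps)
    finally show ?thesis using pp by (simp add: mult_nonpos_nonneg)
  qed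
qed

section \<open>Return to the coordinates \<open>(x, y)\<close>\<close>

definition V :: "real \<Rightarrow> real \<Rightarrow> real" where
  "V x y = U (x + \<bar>y\<bar>) (\<bar>y\<bar> - x)"
definition Vx :: "real \<Rightarrow> real \<Rightarrow> real" where
  "Vx x y = Us (x + \<bar>y\<bar>) (\<bar>y\<bar> - x) - Uc (x + \<bar>y\<bar>) (\<bar>y\<bar> - x)"
definition Vy :: "real \<Rightarrow> real \<Rightarrow> real" where
  "Vy x y = (if 0 \<le> y then 1 else -1) * (Us (x + \<bar>y\<bar>) (\<bar>y\<bar> - x) + Uc (x + \<bar>y\<bar>) (\<bar>y\<bar> - x))"

lemma V_tangent_nonneg:
  assumes "0 < x" "0 < x'" "0 \<le> y" "0 \<le> y'" "\<bar>y' - y\<bar> \<le> \<bar>x' - x\<bar>"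
  shows "V x' y' \<le> V x y + Vx x y * (x' - x) + Vy x y * (y' - y)"
proof -
  have "(y' - y)\<^sup>2 \<le> (x' - x)\<^sup>2" using assms(5) by (simp add: abs_le_square_iff)
  then have "((x' + y') - (x + y)) * ((y' - x') - (y - x)) \<le> 0" by (simp add: algebra_simps power2_eq_square)
  then have "U (x' + y') (y' - x') \<le> U (x + y) (y - x) + Us (x + y) (y - x) * ((x' + y') - (x + y))
      + Uc (x + y) (y - x) * ((y' - x') - (y - x))"
    using assms by (intro U_tangent) auto
  then show ?thesis using assms by (simp add: V_def Vx_def Vy_def algebra_simps)
qed

text \<open>When the segment crosses the axis at \<open>z\<close>, the tangent planes at its start and at \<open>z\<close> are compared;
  the kink of \<open>V\<close> on the axis is concave by \<open>gradient_axis\<close>.\<close>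
lemma V_tangent_from_nonneg:
  assumes x: "0 < x" "0 < x'" and y: "0 \<le> y" and k: "\<bar>y' - y\<bar> \<le> \<bar>x' - x\<bar>"
  shows "V x' y' \<le> V x y + Vx x y * (x' - x) + Vy x y * (y' - y)"
proof (cases "0 \<le> y'")
  case True then show ?thesis using V_tangent_nonneg assms by blast
next
  case False
  define t where "t = y / (y - y')"
  have t: "0 \<le> t" "t < 1" "y = t * (y - y')" using y False by (auto simp: t_def)
  define h k where "h = x' - x" and "k = y' - y"
  define z where "z = x + t * h"
  have "z = (1 - t) * x + t * x'" by (simp add: z_def h_def algebra_simps)
  then have z: "0 < z" using t x by (smt (verit) mult_nonneg_nonneg mult_pos_pos)
  have yk: "y = - (t * k)" "y' = (1 - t) * k" using t by (auto simp: k_def algebra_simps)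
  have hx: "x' - z = (1 - t) * h" by (simp add: z_def h_def algebra_simps)
  have hk: "\<bar>k\<bar> \<le> \<bar>h\<bar>" using k by (simp add: h_def k_def)
  have thk: "\<bar>t * k\<bar> \<le> \<bar>t * h\<bar>" "\<bar>(1 - t) * k\<bar> \<le> \<bar>(1 - t) * h\<bar>"
    using hk t by (auto simp: abs_mult intro!: mult_left_mono)
  have V0: "Vy z 0 \<le> 0" using gradient_axis[OF z] by (simp add: Vy_def)
  define A0 AP where "A0 = Vx z 0 * h + Vy z 0 * k" and "AP = Vx x y * h + Vy x y * k"
  have a: "V x' y' \<le> V z 0 + (1 - t) * A0"
  proof -
    \<comment> \<open>As \<open>V\<close> is even in \<open>y\<close>, the endpoint may be reflected
      into the upper half plane; the sign of \<open>Vy z 0\<close> turns the bound back into one for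
      \<open>y'\<close> itself.\<close>
    have "V x' (- y') \<le> V z 0 + Vx z 0 * (x' - z) + Vy z 0 * (- y' - 0)"
      by (rule V_tangent_nonneg) (use x z False thk hx yk in auto)
    also have "V x' (- y') = V x' y'" by (simp add: V_def)
    also have "Vy z 0 * (- y' - 0) \<le> Vy z 0 * y'" using V0 False by (intro mult_left_mono_neg) auto
    finally show ?thesis unfolding hx yk(2) by (simp add: A0_def algebra_simps)
  qed
  have b: "V x y \<le> V z 0 - t * A0"
    using V_tangent_nonneg[of z x 0 y] x z y thk yk by (simp add: z_def A0_def algebra_simps)
  have c: "V z 0 \<le> V x y + t * AP"
    using V_tangent_nonneg[of x z y 0] x z y thk yk(1) by (simp add: z_def AP_def algebra_simps)
  \<comment> \<open>The two tangent bounds between the start and the crossing point compare the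
    directional slopes \<open>A0\<close> and \<open>AP\<close>. For \<open>t = 0\<close> the start
    is the crossing point.\<close>
  have "(1 - t) * A0 \<le> (1 - t) * AP"
  proof (cases "t = 0")
    case True then show ?thesis using yk by (simp add: z_def A0_def AP_def)
  next
    case False
    have "t * A0 \<le> t * AP" using b c by linarith
    then have "A0 \<le> AP" using False t by simp
    then show ?thesis using t by (intro mult_left_mono) auto
  qed
  then have "V x' y' \<le> V x y + AP" using a c by (simp add: algebra_simps)
  then show ?thesis by (simp add: AP_def h_def k_def)
qed

lemma V_tangent:
  assumes x: "0 < x" "0 < x'" and k: "\<bar>y' - y\<bar> \<le> \<bar>x' - x\<bar>"
  shows "V x' y' \<le> V x y + Vx x y * (x' - x) + Vy x y * (y' - y)"
proof (cases "0 \<le> y")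
  case True then show ?thesis using V_tangent_from_nonneg assms by blast
next
  case False
  have "V x' (- y') \<le> V x (- y) + Vx x (- y) * (x' - x) + Vy x (- y) * (- y' - - y)"
    using False assms by (intro V_tangent_from_nonneg) auto
  then show ?thesis using False by (simp add: V_def Vx_def Vy_def algebra_simps)
qed

text \<open>Quadratic growth of \<open>V\<close> and linear growth of its slopes give integrability
  under finite \<open>p\<close>-th moments with \<open>p > 2\<close>. With \<open>x \<ge> e\<close>
  and \<open>\<bar>y\<bar> < 1\<close> one has \<open>1 - c \<ge> e\<close>, which controls
  \<open>F\<close> and \<open>F'\<close>.\<close>

lemma V_bounds:
  assumes e: "0 < e"
  shows "\<exists>C. \<forall>x\<ge>e. \<forall>y. \<bar>y\<bar> < 1 \<longrightarrow> \<bar>V x y\<bar> \<le> C * (1 + x)\<^sup>2 \<and> \<bar>Vx x y\<bar> \<le> C * (1 + x) \<and> \<bar>Vy x y\<bar> \<le> C * (1 + x)"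
proof -
  define D where "D = 4 * p + p\<^sup>2 + 2 / e + 2 / e\<^sup>2"
  have pp: "4 \<le> p * p" using p mult_mono[of 2 p 2 p] by simp
  have D0: "0 \<le> 2 / e" "0 \<le> 2 / e\<^sup>2" using e by auto
  have main: "\<bar>U s c\<bar> \<le> D * (1 + x)\<^sup>2 \<and> \<bar>Us s c\<bar> \<le> D * (1 + x) \<and> \<bar>Uc s c\<bar> \<le> D * (1 + x)"
    if x: "e \<le> x" and w: "0 \<le> w" "w < 1" and sc: "s = x + w" "c = w - x" for x w s c
  proof -
    have s: "0 < s" and xx: "s - c = 2 * x" and x0: "0 < x" using that e by auto
    have "0 \<le> D" using D0 p by (simp add: D_def)
    then have D1: "D * 1 \<le> D * (1 + x)" "D * 1 \<le> D * (1 + x)\<^sup>2"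
      using x0 by (intro mult_left_mono one_le_power; simp)+
    consider "1 \<le> s" | "s < 1" "\<beta> * s \<le> c" | "s < 1" "c < \<beta> * s" by linarith
    then show ?thesis
    proof cases
      case 1
      have d: "0 \<le> s - 1" "s - 1 \<le> x" "0 \<le> 1 - c" "1 - c \<le> 1 + x" using 1 sc w x0 by auto
      have q: "0 \<le> p\<^sup>2 / 4 * (s - 1) * (1 - c)" "p\<^sup>2 / 4 * (s - 1) * (1 - c) \<le> p\<^sup>2 / 4 * (1 + x) * (1 + x)"
        using d x0 by (auto intro!: mult_mono)
      have q2: "0 \<le> p * (s - 1)" "p * (s - 1) \<le> p * (1 + x)" "0 \<le> \<gamma> * x" "\<gamma> * x \<le> p * (1 + x)"
        "0 \<le> p\<^sup>2 / 4 * (s - 1)" "p\<^sup>2 / 4 * (s - 1) \<le> p\<^sup>2 / 4 * (1 + x)"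
        "0 \<le> p\<^sup>2 / 4 * (1 - c)" "p\<^sup>2 / 4 * (1 - c) \<le> p\<^sup>2 / 4 * (1 + x)"
        using d x0 p gamma by (auto intro!: mult_mono)
      have q3: "p * (1 + x) \<le> p * (1 + x)\<^sup>2" "p * 1 \<le> p * (1 + x)"
        using x0 p by (auto intro!: mult_left_mono self_le_power)
      have q4: "1 \<le> p * (1 + x)\<^sup>2" using q3 p by linarith
      have "D * (1 + x)\<^sup>2 = 4 * (p * (1 + x)\<^sup>2) + 4 * (p\<^sup>2 / 4 * (1 + x) * (1 + x)) + 2 / e * (1 + x)\<^sup>2 + 2 / e\<^sup>2 * (1 + x)\<^sup>2"
        by (simp add: D_def algebra_simps power2_eq_square)
      moreover have "D * (1 + x) = 4 * (p * (1 + x)) + 4 * (p\<^sup>2 / 4 * (1 + x)) + 2 / e * (1 + x) + 2 / e\<^sup>2 * (1 + x)"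
        by (simp add: D_def algebra_simps power2_eq_square)
      moreover have "0 \<le> 2 / e * (1 + x)\<^sup>2" "0 \<le> 2 / e\<^sup>2 * (1 + x)\<^sup>2" "0 \<le> 2 / e * (1 + x)" "0 \<le> 2 / e\<^sup>2 * (1 + x)"
        "0 \<le> p\<^sup>2 / 4 * (1 + x) * (1 + x)" "0 \<le> p\<^sup>2 / 4 * (1 + x)" using D0 x0 by auto
      moreover have "U s c = 1 + p * (s - 1) - p\<^sup>2 / 4 * (s - 1) * (1 - c) - \<gamma> * x"
        "Us s c = p - p\<^sup>2 / 4 * (1 - c) - \<gamma> / 2" "Uc s c = p\<^sup>2 / 4 * (s - 1) + \<gamma> / 2"
        using 1 xx by (simp_all add: U_def Us_def Uc_def)
      ultimately show ?thesis using q q2 q3 q4 gamma(1,2) p unfolding abs_le_iff by (intro conjI) linarith+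
    next
      case 2
      have "0 < \<beta> * s" using s beta by simp
      then have c0: "0 < c" "c < 1" using 2 sc x0 w by auto
      have u: "e \<le> 1 - c" using sc x w by simp
      have F0: "0 \<le> F c" using F_nonneg c0 by simp
      have c2: "2 / (1 - c) \<le> 2 / e" using u e by (intro divide_left_mono) auto
      have c3: "2 / (1 - c)\<^sup>2 \<le> 2 / e\<^sup>2" using u e c0 by (intro divide_left_mono power_mono mult_pos_pos) auto
      have F1: "F c \<le> p + 2 / e"
      proof (cases "\<beta> \<le> c")
        case True then show ?thesis using c2 gamma p by (simp add: F_def)
      next
        case False
        then have "F c \<le> F \<beta>" using F_mono[of c \<beta>] c0 beta by simp
        moreover have "F \<beta> = p - \<gamma>" using F_beta' by (simp add: F_def)
        ultimately show ?thesis using gamma(1) D0(1) by linarith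
      qed
      have F': "0 \<le> F' c" "F' c \<le> p\<^sup>2 / 2 + 2 / e\<^sup>2"
      proof -
        have k: "0 \<le> \<gamma> * \<beta> powr (2 - p) * (p - 1)" using gamma p by simp
        show "0 \<le> F' c" using k p gamma by (auto simp: F'_def)
        show "F' c \<le> p\<^sup>2 / 2 + 2 / e\<^sup>2"
        proof (cases "\<beta> \<le> c")
          case True
          then have "F' c = 2 / (1 - c)\<^sup>2" by (simp add: F'_def)
          then show ?thesis using c3 zero_le_power2[of p] by linarith
        next
          case False
          have "F' c = \<gamma> * \<beta> powr (2 - p) * (p - 1) * c powr (p - 2)" using False by (simp add: F'_def)
          also have "\<dots> \<le> \<gamma> * \<beta> powr (2 - p) * (p - 1) * \<beta> powr (p - 2)"
            using k False c0 p by (intro mult_left_mono powr_mono2) auto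
          also have "\<dots> = p\<^sup>2 / 2" using F'_beta by (simp add: mult.assoc)
          finally show ?thesis using D0(2) by linarith
        qed
      qed
      have x1: "x \<le> 1" using 2 sc w by simp
      have "x * F c \<le> 1 * F c" "x * F' c \<le> 1 * F' c" "0 \<le> x * F c" "0 \<le> x * F' c"
        using x1 F0 F' x0 by (intro mult_right_mono mult_nonneg_nonneg; simp)+
      moreover have "U s c = x * F c" "Us s c = F c / 2" "Uc s c = x * F' c - F c / 2"
        using 2 xx by (simp_all add: U_def Us_def Uc_def)
      moreover note D1
      moreover have "p + 2 / e \<le> D" "p + 2 / e + (p\<^sup>2 / 2 + 2 / e\<^sup>2) \<le> D" using D0 p by (auto simp: D_def)
      ultimately show ?thesis using F0 F1 F' unfolding abs_le_iff by (intro conjI) linarith+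
    next
      case 3
      have x1: "x \<le> 1" using 3 sc w by simp
      have pw: "s powr a \<le> 1" if "0 \<le> a" for a using that 3 s powr_le1[of a s] by simp
      have pw': "\<gamma> * x * s powr (p - 1) \<le> p * 1 * 1" "p\<^sup>2 / 2 * x * s powr (p - 2) \<le> p\<^sup>2 / 2 * 1 * 1"
         "(p - \<gamma> / 2) * s powr (p - 1) \<le> p * 1" "\<gamma> / 2 * s powr (p - 1) \<le> p * 1"
        using x0 x1 gamma p pw by (intro mult_mono; auto)+
      have pw0: "0 \<le> \<gamma> * x * s powr (p - 1)" "0 \<le> p\<^sup>2 / 2 * x * s powr (p - 2)"
        "0 \<le> (p - \<gamma> / 2) * s powr (p - 1)" "0 \<le> \<gamma> / 2 * s powr (p - 1)" "0 \<le> s powr p" "s powr p \<le> 1"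
        using x0 gamma p pw by auto
      moreover have "U s c = s powr p - \<gamma> * x * s powr (p - 1)"
        "Us s c = (p - \<gamma> / 2) * s powr (p - 1) - p\<^sup>2 / 2 * x * s powr (p - 2)" "Uc s c = \<gamma> / 2 * s powr (p - 1)"
        using 3 xx by (simp_all add: U_def Us_def Uc_def)
      moreover note D1
      moreover have "4 * p + p\<^sup>2 \<le> D" using D0 by (auto simp: D_def)
      ultimately show ?thesis using pw' p zero_le_power2[of p] unfolding abs_le_iff by (intro conjI) linarith+
    qed
  qed
  show ?thesis
  proof (intro exI[of _ "2 * D"] allI impI)
    fix x y :: real assume "e \<le> x" "\<bar>y\<bar> < 1"
    then have m: "\<bar>V x y\<bar> \<le> D * (1 + x)\<^sup>2" "\<bar>Us (x + \<bar>y\<bar>) (\<bar>y\<bar> - x)\<bar> \<le> D * (1 + x)"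
      "\<bar>Uc (x + \<bar>y\<bar>) (\<bar>y\<bar> - x)\<bar> \<le> D * (1 + x)" using main[of x "\<bar>y\<bar>"] by (auto simp: V_def)
    then show "\<bar>V x y\<bar> \<le> 2 * D * (1 + x)\<^sup>2 \<and> \<bar>Vx x y\<bar> \<le> 2 * D * (1 + x) \<and> \<bar>Vy x y\<bar> \<le> 2 * D * (1 + x)"
      by (auto simp: Vx_def Vy_def abs_if split: if_splits)
  qed
qed

lemma F_measurable [measurable]: "F \<in> borel_measurable borel" "F' \<in> borel_measurable borel"
  unfolding F_def[abs_def] F'_def[abs_def] by measurable

lemma V_measurable [measurable]:
  assumes [measurable]: "X \<in> borel_measurable M" "Y \<in> borel_measurable M"
  shows "(\<lambda>\<omega>. V (X \<omega>) (Y \<omega>)) \<in> borel_measurable M" "(\<lambda>\<omega>. Vx (X \<omega>) (Y \<omega>)) \<in> borel_measurable M"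
    "(\<lambda>\<omega>. Vy (X \<omega>) (Y \<omega>)) \<in> borel_measurable M"
  unfolding V_def Vx_def Vy_def U_def Us_def Uc_def by measurable

end

section \<open>Martingale inequalities\<close>

lemma martingaleD:
  assumes "is_martingale M F f"
  shows "subalgebra M (F n)" "f n \<in> borel_measurable (F n)" "integrable M (f n)"
    "f n \<in> borel_measurable M" "n \<le> m \<Longrightarrow> subalgebra (F m) (F n)"
    "A \<in> sets (F n) \<Longrightarrow> (\<integral>x\<in>A. f (Suc n) x \<partial>M) = (\<integral>x\<in>A. f n x \<partial>M)"
  using assms by (auto simp: is_martingale_def is_filtration_def subalgebra_def)

lemma martingale_measurable_le:
  assumes "is_martingale M F f" "n \<le> m" shows "f n \<in> borel_measurable (F m)"
  using martingaleD(2,5)[OF assms(1)] assms(2) by (blast intro: measurable_from_subalg)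

text \<open>The set integrals identify the conditional expectation of the increment as 0; pulling
  out \<open>P\<close> then asks for integrability of the product only.\<close>

lemma martingale_increment_orthogonal:
  assumes "prob_space M" and f: "is_martingale M F f"
    and P: "P \<in> borel_measurable (F n)"
    and int: "integrable M (\<lambda>x. P x * (f (Suc n) x - f n x))"
  shows "(\<integral>x. P x * (f (Suc n) x - f n x) \<partial>M) = 0"
proof -
  interpret prob_space M by fact
  interpret S: finite_measure_subalgebra M "F n"
    by (standard) (rule martingaleD(1)[OF f])
  note [measurable] = martingaleD(4)[OF f]
  note fi = martingaleD(3)[OF f]
  have "AE x in M. real_cond_exp M (F n) (\<lambda>x. f (Suc n) x - f n x) x = 0"
  proof (rule S.real_cond_exp_charact)
    fix A assume A: "A \<in> sets (F n)"
    then have AM: "A \<in> sets M" using martingaleD(1)[OF f] by (auto simp: subalgebra_def)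
    have "set_integrable M A (f k)" for k
      unfolding set_integrable_def by (rule integrable_mult_indicator[OF AM fi])
    then show "(\<integral>x\<in>A. (f (Suc n) x - f n x) \<partial>M) = (\<integral>x\<in>A. 0 \<partial>M)"
      using martingaleD(6)[OF f A] by (subst set_integral_diff) auto
  qed (use fi in auto)
  then have "AE x in M. real_cond_exp M (F n) (\<lambda>x. P x * (f (Suc n) x - f n x)) x = 0"
    using S.real_cond_exp_mult[OF P _ int] by auto
  then have "(\<integral>x. real_cond_exp M (F n) (\<lambda>x. P x * (f (Suc n) x - f n x)) x \<partial>M) = 0"
    by (subst integral_cong_AE[where g="\<lambda>_. 0"]) auto
  then show ?thesis using S.real_cond_exp_int(2)[OF int] by simp
qed

lemma martingale_set_integral:
  assumes f: "is_martingale M F f" and A: "A \<in> sets (F 0)"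
  shows "(\<integral>x\<in>A. f n x \<partial>M) = (\<integral>x\<in>A. f 0 x \<partial>M)"
proof (induction n)
  case (Suc n)
  have "A \<in> sets (F n)" using A martingaleD(5)[OF f, of 0 n] by (auto simp: subalgebra_def)
  then show ?case using Suc martingaleD(6)[OF f] by simp
qed simp

lemma martingale_scale:
  assumes "is_martingale M F f" shows "is_martingale M F (\<lambda>n x. f n x / c)"
  using assms by (auto simp: is_martingale_def intro: borel_measurable_divide borel_measurable_const)

text \<open>\<open>P\<close> and \<open>Q\<close> are the slopes of a tangent plane to the potential
  \<open>W\<close>; their increments integrate to 0 over \<open>A\<close>. Restricting to
  \<open>A\<close> in \<open>F 0\<close> allows conditioning on the first step.\<close>

lemma potential_decreasing:
  assumes M: "prob_space M" and f: "is_martingale M F f" and g: "is_martingale M F g"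
    and A: "A \<in> sets (F 0)"
    and W: "\<And>n. integrable M (W n)"
    and P: "\<And>n. P n \<in> borel_measurable (F n)" and Q: "\<And>n. Q n \<in> borel_measurable (F n)"
    and Pi: "\<And>n. integrable M (\<lambda>x. P n x * (f (Suc n) x - f n x))"
    and Qi: "\<And>n. integrable M (\<lambda>x. Q n x * (g (Suc n) x - g n x))"
    and step: "\<And>n. AE x in M. W (Suc n) x \<le> W n x + P n x * (f (Suc n) x - f n x) + Q n x * (g (Suc n) x - g n x)"
  shows "(\<integral>x\<in>A. W n x \<partial>M) \<le> (\<integral>x\<in>A. W 0 x \<partial>M)"
proof (induction n)
  case (Suc n)
  have An: "A \<in> sets (F n)" using A martingaleD(5)[OF f, of 0 n] by (auto simp: subalgebra_def)
  then have AM: "A \<in> sets M" using martingaleD(1)[OF f] by (auto simp: subalgebra_def)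
  have i: "integrable M (\<lambda>x. indicator A x * h x)" if "integrable M h" for h :: "'a \<Rightarrow> real"
    using integrable_mult_indicator[OF AM that] by simp
  have P0: "(\<integral>x. (indicator A x * P n x) * (f (Suc n) x - f n x) \<partial>M) = 0"
    by (rule martingale_increment_orthogonal[OF M f]) (use P An i[OF Pi] in \<open>auto simp: mult.assoc\<close>)
  have Q0: "(\<integral>x. (indicator A x * Q n x) * (g (Suc n) x - g n x) \<partial>M) = 0"
    by (rule martingale_increment_orthogonal[OF M g]) (use Q An i[OF Qi] in \<open>auto simp: mult.assoc\<close>)
  have "(\<integral>x\<in>A. W (Suc n) x \<partial>M) \<le> (\<integral>x. indicator A x * W n x + (indicator A x * P n x) * (f (Suc n) x - f n x)
      + (indicator A x * Q n x) * (g (Suc n) x - g n x) \<partial>M)"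
    unfolding set_lebesgue_integral_def
  proof (rule integral_mono_AE)
    show "AE x in M. indicator A x *\<^sub>R W (Suc n) x \<le> indicator A x * W n x
        + (indicator A x * P n x) * (f (Suc n) x - f n x) + (indicator A x * Q n x) * (g (Suc n) x - g n x)"
      using step[of n] by eventually_elim (auto simp: indicator_def)
  qed (use i[OF W] i[OF Pi] i[OF Qi] in \<open>auto simp: mult.assoc\<close>)
  also have "\<dots> = (\<integral>x\<in>A. W n x \<partial>M)"
    using P0 Q0 i[OF W] i[OF Pi] i[OF Qi]
    by (subst Bochner_Integration.integral_add; simp add: mult.assoc set_lebesgue_integral_def)+
  finally show ?case using Suc by simp
qed simp

lemma subordinateD:
  assumes "diff_subordinate M g f"
  shows "AE x in M. \<bar>g 0 x\<bar> \<le> \<bar>f 0 x\<bar>" "AE x in M. \<bar>g (Suc n) x - g n x\<bar> \<le> \<bar>f (Suc n) x - f n x\<bar>"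
  using assms[unfolded diff_subordinate_def, rule_format, of 0] assms[unfolded diff_subordinate_def, rule_format, of "Suc n"]
  by (simp_all add: dseq_def)

lemma subordinate_scale:
  assumes "diff_subordinate M g f" "0 < c"
  shows "diff_subordinate M (\<lambda>n x. g n x / c) (\<lambda>n x. f n x / c)"
proof -
  have "AE x in M. \<bar>dseq (\<lambda>n x. g n x / c) n x\<bar> \<le> \<bar>dseq (\<lambda>n x. f n x / c) n x\<bar>" for n
  proof -
    have "dseq (\<lambda>n x. h n x / c) n x = dseq h n x / c" for h :: "nat \<Rightarrow> 'a \<Rightarrow> real" and x
      by (simp add: dseq_def diff_divide_distrib)
    moreover have "AE x in M. \<bar>dseq g n x\<bar> \<le> \<bar>dseq f n x\<bar>" using assms by (simp add: diff_subordinate_def)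
    ultimately show ?thesis using assms(2) by (auto elim!: eventually_mono simp: divide_right_mono)
  qed
  then show ?thesis by (simp add: diff_subordinate_def)
qed

section \<open>Exponents at most 1\<close>

lemma weak_potential_exit:
  fixes x y x' y' :: real
  assumes "0 \<le> x" "0 \<le> x'" "x + \<bar>y\<bar> < 1" "1 \<le> x' + \<bar>y'\<bar>" "\<bar>y' - y\<bar> \<le> \<bar>x' - x\<bar>"
  shows "1 - 2 * x' \<le> y\<^sup>2 - x\<^sup>2 - 2 * x * (x' - x) + 2 * y * (y' - y)"
\<comment> \<open>Here \<open>1 - 2 * x' \<le> y'^2 - x'^2\<close>, and the tangent plane dominates
  that. In the other case the jump \<open>h = x' - x\<close> is large,
  \<open>2 * h \<ge> 1 - x + \<bar>y\<bar>\<close>, and the difference of the two sides is at least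
  \<open>(1 - x - \<bar>y\<bar>) * (2 * h - (1 - x + \<bar>y\<bar>))\<close>.\<close>
proof (cases "\<bar>1 - x'\<bar> \<le> \<bar>y'\<bar>")
  case True
  then have "(1 - x')\<^sup>2 \<le> y'\<^sup>2" by (simp add: abs_le_square_iff)
  moreover have "(y' - y)\<^sup>2 \<le> (x' - x)\<^sup>2" using assms(5) by (simp add: abs_le_square_iff)
  ultimately show ?thesis by (simp add: algebra_simps power2_eq_square)
next
  case False
  then have x': "x' > 1" "\<bar>y'\<bar> < x' - 1" using assms by auto
  define h where "h = x' - x"
  have h: "0 < h" "1 - x + \<bar>y\<bar> \<le> 2 * h" using x' assms by (auto simp: h_def)
  have "0 \<le> (1 - (x + \<bar>y\<bar>)) * (2 * h - (1 - x + \<bar>y\<bar>))" using h assms by (intro mult_nonneg_nonneg) auto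
  moreover have "- (\<bar>y\<bar> * h) \<le> y * (y' - y)"
  proof -
    have "\<bar>y * (y' - y)\<bar> \<le> \<bar>y\<bar> * h" using assms(5) h by (auto simp: abs_mult h_def intro: mult_left_mono)
    then show ?thesis by linarith
  qed
  ultimately show ?thesis unfolding h_def by (simp add: algebra_simps power2_eq_square abs_if split: if_splits)
qed

lemma weak_type_small_exponent:
  assumes M: "prob_space M" and f: "is_martingale M F f" and g: "is_martingale M F g"
    and f0: "\<And>n. AE x in M. f n x \<ge> 0" and sub: "diff_subordinate M g f"
    and p: "0 < p" "p \<le> 1"
  shows "measure M {x \<in> space M. \<exists>j\<le>n. 1 \<le> \<bar>g j x\<bar>} \<le> (\<integral>x. \<bar>2 * f 0 x\<bar> powr p \<partial>M)"
proof -
  interpret prob_space M by fact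
  note [measurable] = martingaleD(4)[OF f] martingaleD(4)[OF g]
  note fi = martingaleD(3)[OF f]
  define B where "B n x \<longleftrightarrow> (\<forall>j\<le>n. \<bar>f j x\<bar> + \<bar>g j x\<bar> < 1)" for n x
  have B_meas: "Measurable.pred (F n) (B n)" for n
  proof -
    have "Measurable.pred (F n) (\<lambda>x. \<bar>f j x\<bar> + \<bar>g j x\<bar> < 1)" if "j \<le> n" for j
      using martingale_measurable_le[OF f that] martingale_measurable_le[OF g that] by measurable
    then have "Measurable.pred (F n) (\<lambda>x. \<forall>j\<in>{..n}. \<bar>f j x\<bar> + \<bar>g j x\<bar> < 1)"
      by (intro pred_intros_finite) auto
    moreover have "B n = (\<lambda>x. \<forall>j\<in>{..n}. \<bar>f j x\<bar> + \<bar>g j x\<bar> < 1)" by (auto simp: B_def)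
    ultimately show ?thesis by (simp only:)
  qed
  have [measurable]: "Measurable.pred M (B n)" for n
    by (rule measurable_from_subalg[OF martingaleD(1)[OF f] B_meas])
  have [measurable]: "f n \<in> borel_measurable (F n)" "g n \<in> borel_measurable (F n)" for n
    using martingaleD(2)[OF f] martingaleD(2)[OF g] by auto
  have Bb: "\<bar>f n x\<bar> \<le> 1" "\<bar>g n x\<bar> \<le> 1" if "B n x" for n x
    using that[unfolded B_def, rule_format, of n] by auto
  \<comment> \<open>After the exit from \<open>x + \<bar>y\<bar> < 1\<close> the potential continues
    as \<open>1 - 2 * f n\<close>, a martingale with slopes -2 and 0.\<close>
  define W where "W n x = (if B n x then (g n x)\<^sup>2 - (f n x)\<^sup>2 else 1 - 2 * f n x)" for n x
  define P where "P n x = (if B n x then - 2 * f n x else - 2)" for n x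
  define Q where "Q n x = (if B n x then 2 * g n x else 0)" for n x
  have PQb: "\<bar>P n x\<bar> \<le> 2" "\<bar>Q n x\<bar> \<le> 2" for n x
    using Bb[of n x] by (auto simp: P_def Q_def abs_mult)
  \<comment> \<open>On \<open>A\<close> almost every start satisfies
    \<open>\<bar>g 0\<bar> \<le> f 0 < 1 / 2\<close>, hence lies in the triangle, and
    \<open>W 0 \<le> 0\<close>. Off \<open>A\<close> the target \<open>(2 * f 0) powr p\<close> is
    at least 1, so the trivial bound for the probability suffices.\<close>
  define A where "A = {x \<in> space M. f 0 x < 1 / 2}"
  have A: "A \<in> sets (F 0)"
  proof -
    have "A = {x \<in> space (F 0). f 0 x < 1 / 2}"
      using martingaleD(1)[OF f, of 0] by (simp add: A_def subalgebra_def)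
    then show ?thesis by simp
  qed
  have [measurable]: "A \<in> sets M" by (auto simp: A_def)
  have Wi: "integrable M (W n)" for n
  proof (rule Bochner_Integration.integrable_bound)
    show "integrable M (\<lambda>x. 2 + 2 * \<bar>f n x\<bar>)" using fi by auto
    have "\<bar>W n x\<bar> \<le> 2 + 2 * \<bar>f n x\<bar>" for x
    proof (cases "B n x")
      case True
      then have "(g n x)\<^sup>2 \<le> 1" "(f n x)\<^sup>2 \<le> 1" using Bb[of n x] by (simp_all add: abs_square_le_1)
      moreover have "0 \<le> (g n x)\<^sup>2" "0 \<le> (f n x)\<^sup>2" by auto
      ultimately show ?thesis using True unfolding W_def by (simp only: if_True)
    qed (auto simp: W_def)
    then show "AE x in M. norm (W n x) \<le> norm (2 + 2 * \<bar>f n x\<bar>)" by (auto intro!: AE_I2)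
  qed (simp add: W_def[abs_def])
  have int: "integrable M (\<lambda>x. R x * (h (Suc n) x - h n x))"
    if R: "R \<in> borel_measurable M" "\<And>x. \<bar>R x\<bar> \<le> 2" and h: "is_martingale M F h" for R h n
  proof (rule Bochner_Integration.integrable_bound)
    note [measurable] = martingaleD(4)[OF h] R(1)
    show "integrable M (\<lambda>x. 2 * (h (Suc n) x - h n x))" using martingaleD(3)[OF h] by auto
    show "(\<lambda>x. R x * (h (Suc n) x - h n x)) \<in> borel_measurable M" by measurable
    show "AE x in M. norm (R x * (h (Suc n) x - h n x)) \<le> norm (2 * (h (Suc n) x - h n x))"
      by (intro AE_I2, simp only: real_norm_def abs_mult abs_numeral) (intro mult_right_mono R(2) abs_ge_zero)
  qed
  have "(\<integral>x\<in>A. W n x \<partial>M) \<le> (\<integral>x\<in>A. W 0 x \<partial>M)"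
  proof (rule potential_decreasing[OF M f g A Wi])
    fix n
    show "P n \<in> borel_measurable (F n)" "Q n \<in> borel_measurable (F n)"
      using B_meas[of n] unfolding P_def Q_def by measurable
    then have PQM: "P n \<in> borel_measurable M" "Q n \<in> borel_measurable M"
      by (auto intro: measurable_from_subalg[OF martingaleD(1)[OF f, of n]])
    show "integrable M (\<lambda>x. P n x * (f (Suc n) x - f n x))" "integrable M (\<lambda>x. Q n x * (g (Suc n) x - g n x))"
      by (intro int f g PQb PQM)+
    show "AE x in M. W (Suc n) x \<le> W n x + P n x * (f (Suc n) x - f n x) + Q n x * (g (Suc n) x - g n x)"
      using f0[of n] f0[of "Suc n"] subordinateD(2)[OF sub, of n]
    proof eventually_elim
      case (elim x)
      have BS: "B (Suc n) x \<longleftrightarrow> B n x \<and> \<bar>f (Suc n) x\<bar> + \<bar>g (Suc n) x\<bar> < 1"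
        by (auto simp: B_def le_Suc_eq)
      have sq: "(g (Suc n) x - g n x)\<^sup>2 \<le> (f (Suc n) x - f n x)\<^sup>2" using elim by (simp add: abs_le_square_iff)
      consider "\<not> B n x" | "B n x" "B (Suc n) x" | "B n x" "\<not> B (Suc n) x" by blast
      then show ?case
      proof cases
        case 1 then show ?thesis using BS by (simp add: W_def P_def Q_def)
      next
        case 2 then show ?thesis using sq by (simp add: W_def P_def Q_def algebra_simps power2_eq_square)
      next
        case 3
        have "f n x + \<bar>g n x\<bar> < 1" using 3 elim unfolding B_def by force
        then show ?thesis using 3 BS weak_potential_exit[of "f n x" "f (Suc n) x" "g n x" "g (Suc n) x"] elim
          by (simp add: W_def P_def Q_def)
      qed
    qed
  qed
  also have "\<dots> \<le> 0"
  proof -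
    have "AE x in M. indicator A x *\<^sub>R W 0 x \<le> 0"
      using f0[of 0] subordinateD(1)[OF sub]
    proof eventually_elim
      case (elim x)
      have "(g 0 x)\<^sup>2 \<le> (f 0 x)\<^sup>2" using elim(2) by (rule abs_le_square_iff[THEN iffD1])
      moreover have "B 0 x" if "f 0 x < 1 / 2" using that elim by (simp add: B_def)
      ultimately show ?case by (auto simp: A_def W_def indicator_def)
    qed
    then have "0 \<le> (\<integral>x. - (indicator A x *\<^sub>R W 0 x) \<partial>M)" by (intro integral_nonneg_AE) auto
    then show ?thesis by (simp add: set_lebesgue_integral_def)
  qed
  finally have W0: "(\<integral>x\<in>A. W n x \<partial>M) \<le> 0" .
  define E where "E = {x \<in> space M. \<exists>j\<le>n. 1 \<le> \<bar>g j x\<bar>}"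
  have [measurable]: "E \<in> sets M" unfolding E_def by measurable
  have ind: "integrable M (indicator D :: 'a \<Rightarrow> real)" if "D \<in> sets M" for D
    using that by (intro integrable_real_indicator) (auto simp: less_top[symmetric])
  have iA: "integrable M (\<lambda>x. indicator A x * h x)" if "integrable M h" for h :: "'a \<Rightarrow> real"
    using integrable_mult_indicator[of A M h] that by simp
  have "(\<integral>x. indicator A x * indicator E x - indicator A x * (2 * f n x) \<partial>M) \<le> (\<integral>x\<in>A. W n x \<partial>M)"
    unfolding set_lebesgue_integral_def
  proof (rule integral_mono_AE)
    show "integrable M (\<lambda>x. indicator A x * indicator E x - indicator A x * (2 * f n x))"
      using fi by (intro Bochner_Integration.integrable_diff iA ind integrable_mult_right) auto
    show "integrable M (\<lambda>x. indicator A x *\<^sub>R W n x)" using iA[OF Wi] by simp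
    show "AE x in M. indicator A x * indicator E x - indicator A x * (2 * f n x) \<le> indicator A x *\<^sub>R W n x"
      using f0[of n]
    proof eventually_elim
      case (elim x)
      have "indicator E x - 2 * f n x \<le> W n x"
      proof (cases "B n x")
        case True
        have "x \<notin> E" using True by (force simp: B_def E_def)
        then have "indicator E x = (0 :: real)" by simp
        moreover have "(f n x)\<^sup>2 \<le> 2 * f n x"
          using mult_right_mono[of "f n x" 2 "f n x"] Bb[OF True] elim by (simp add: power2_eq_square)
        ultimately show ?thesis using True zero_le_power2[of "g n x"]
          unfolding W_def by (simp only: if_True)
      qed (auto simp: W_def indicator_def)
      then show ?case by (auto simp: indicator_def split: if_splits)
    qed
  qed
  moreover have "(\<integral>x. indicator A x * indicator E x - indicator A x * (2 * f n x) \<partial>M)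
      = (\<integral>x. indicator A x * indicator E x \<partial>M) - (\<integral>x. indicator A x * (2 * f 0 x) \<partial>M)"
  proof (subst Bochner_Integration.integral_diff)
    have "(\<integral>x. indicator A x * (2 * f n x) \<partial>M) = (\<integral>x. indicator A x * (2 * f 0 x) \<partial>M)"
      using martingale_set_integral[OF f A, of n]
      by (simp add: set_lebesgue_integral_def mult.left_commute[of _ "2::real"])
    then show "(\<integral>x. indicator A x * indicator E x \<partial>M) - (\<integral>x. indicator A x * (2 * f n x) \<partial>M)
      = (\<integral>x. indicator A x * indicator E x \<partial>M) - (\<integral>x. indicator A x * (2 * f 0 x) \<partial>M)" by simp
  qed (use fi in \<open>auto intro!: iA ind\<close>)
  ultimately have key: "(\<integral>x. indicator A x * indicator E x \<partial>M) \<le> (\<integral>x. indicator A x * (2 * f 0 x) \<partial>M)"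
    using W0 by linarith
  have "measure M E = (\<integral>x. indicator E x \<partial>M)" by simp
  also have "\<dots> \<le> (\<integral>x. indicator A x * indicator E x + indicator (space M - A) x \<partial>M)"
    by (intro integral_mono iA ind Bochner_Integration.integrable_add) (auto simp: indicator_def)
  also have "\<dots> = (\<integral>x. indicator A x * indicator E x \<partial>M) + (\<integral>x. indicator (space M - A) x \<partial>M)"
    by (intro Bochner_Integration.integral_add iA ind) auto
  also have "\<dots> \<le> (\<integral>x. indicator A x * (2 * f 0 x) \<partial>M) + (\<integral>x. indicator (space M - A) x \<partial>M)"
    using key by simp
  also have "\<dots> = (\<integral>x. indicator A x * (2 * f 0 x) + indicator (space M - A) x \<partial>M)"
    using fi by (intro Bochner_Integration.integral_add[symmetric] iA ind integrable_mult_right) auto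
  also have "\<dots> \<le> (\<integral>x. \<bar>2 * f 0 x\<bar> powr p \<partial>M)"
  proof (rule integral_mono_AE)
    show "integrable M (\<lambda>x. \<bar>2 * f 0 x\<bar> powr p)"
    proof (rule Bochner_Integration.integrable_bound)
      show "integrable M (\<lambda>x. 1 + \<bar>2 * f 0 x\<bar>)" using fi[of 0] by auto
      have "t powr p \<le> 1 + t" if "0 \<le> t" for t :: real
      proof (cases "t \<le> 1")
        case True then show ?thesis using that p powr_le1[of p t] by linarith
      next
        case False then show ?thesis using p powr_mono[of p 1 t] by simp
      qed
      then show "AE x in M. norm (\<bar>2 * f 0 x\<bar> powr p) \<le> norm (1 + \<bar>2 * f 0 x\<bar>)" by auto
    qed simp
    show "integrable M (\<lambda>x. indicator A x * (2 * f 0 x) + indicator (space M - A) x)"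
      using fi by (intro Bochner_Integration.integrable_add iA ind integrable_mult_right) auto
    show "AE x in M. indicator A x * (2 * f 0 x) + indicator (space M - A) x \<le> \<bar>2 * f 0 x\<bar> powr p"
      using f0[of 0] AE_space
    proof eventually_elim
      case (elim x)
      show ?case
      proof (cases "f 0 x < 1 / 2")
        case True
        have "2 * f 0 x \<le> \<bar>2 * f 0 x\<bar> powr p"
          using True p elim powr_mono'[of p 1 "2 * f 0 x"] by (cases "f 0 x = 0") auto
        then show ?thesis using True elim by (simp add: A_def)
      next
        case False
        then have "1 \<le> \<bar>2 * f 0 x\<bar> powr p" using p by (intro ge_one_powr_ge_zero) auto
        then show ?thesis using False elim by (simp add: A_def)
      qed
    qed
  qed
  finally show ?thesis by (simp add: E_def)
qed

section \<open>Exponents at least 2\<close>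

lemma powr_sum_integrable:
  fixes u v :: "'a \<Rightarrow> real"
  assumes "prob_space M" "0 < p" and [measurable]: "u \<in> borel_measurable M" "v \<in> borel_measurable M"
    and u: "integrable M (\<lambda>x. \<bar>u x\<bar> powr p)" and v: "integrable M (\<lambda>x. \<bar>v x\<bar> powr p)" and c: "0 \<le> c"
  shows "integrable M (\<lambda>x. (c + \<bar>u x\<bar> + \<bar>v x\<bar>) powr p)"
proof (rule Bochner_Integration.integrable_bound)
  interpret prob_space M by fact
  show "integrable M (\<lambda>x. 3 powr p * (c powr p + \<bar>u x\<bar> powr p + \<bar>v x\<bar> powr p))"
    using u v by auto
  have "(c + a + b) powr p \<le> 3 powr p * (c powr p + a powr p + b powr p)" if "0 \<le> a" "0 \<le> b" for a b :: real
  proof -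
    define m where "m = max c (max a b)"
    have "(c + a + b) powr p \<le> (3 * m) powr p" using that c assms(2) by (intro powr_mono2) (auto simp: m_def)
    also have "\<dots> = 3 powr p * m powr p" by (rule powr_mult)
    also have "m powr p \<le> c powr p + a powr p + b powr p" by (auto simp: m_def max_def)
    finally show ?thesis by simp
  qed
  then show "AE x in M. norm ((c + \<bar>u x\<bar> + \<bar>v x\<bar>) powr p) \<le> norm (3 powr p * (c powr p + \<bar>u x\<bar> powr p + \<bar>v x\<bar> powr p))"
    by (auto intro!: AE_I2)
qed simp

text \<open>The shift by \<open>e\<close> keeps the first coordinate away from 0, where the gradient of the special function
  is unbounded near \<open>(0, 1)\<close>.\<close>
lemma bellman_weak_type:
  fixes M :: "'a measure" and U P Q :: "real \<Rightarrow> real \<Rightarrow> real"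
  assumes M: "prob_space M" and f: "is_martingale M F f" and g: "is_martingale M F g"
    and f0: "\<And>n. AE x in M. f n x \<ge> 0" and sub: "diff_subordinate M g f"
    and p: "2 \<le> p" and e: "0 < e" and K: "1 \<le> K" and C: "0 \<le> C"
    and fp: "\<And>n. integrable M (\<lambda>x. \<bar>f n x\<bar> powr p)"
    and meas: "\<And>(N :: 'a measure) X Y. X \<in> borel_measurable N \<Longrightarrow> Y \<in> borel_measurable N \<Longrightarrow>
        (\<lambda>\<omega>. U (X \<omega>) (Y \<omega>)) \<in> borel_measurable N \<and> (\<lambda>\<omega>. P (X \<omega>) (Y \<omega>)) \<in> borel_measurable N
        \<and> (\<lambda>\<omega>. Q (X \<omega>) (Y \<omega>)) \<in> borel_measurable N"
    and tangent: "\<And>x y x' y'. e \<le> x \<Longrightarrow> e \<le> x' \<Longrightarrow> \<bar>y\<bar> < 1 \<Longrightarrow> \<bar>y' - y\<bar> \<le> \<bar>x' - x\<bar> \<Longrightarrow>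
        (if \<bar>y'\<bar> < 1 then U x' y' else 1 - K * x' powr p) \<le> U x y + P x y * (x' - x) + Q x y * (y' - y)"
    and lower: "\<And>x y. e \<le> x \<Longrightarrow> \<bar>y\<bar> < 1 \<Longrightarrow> - (K * x powr p) \<le> U x y"
    and start: "\<And>x y. e \<le> x \<Longrightarrow> \<bar>y\<bar> < 1 \<Longrightarrow> \<bar>y\<bar> \<le> x \<Longrightarrow> U x y \<le> 0"
    and bound: "\<And>x y. e \<le> x \<Longrightarrow> \<bar>y\<bar> < 1 \<Longrightarrow>
        \<bar>U x y\<bar> \<le> C * (1 + x)\<^sup>2 \<and> \<bar>P x y\<bar> \<le> C * (1 + x) \<and> \<bar>Q x y\<bar> \<le> C * (1 + x)"
  shows "measure M {x \<in> space M. \<exists>j\<le>n. 1 \<le> \<bar>g j x\<bar>} \<le> K * (\<integral>x. (\<bar>f n x\<bar> + e) powr p \<partial>M)"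
proof -
  interpret prob_space M by fact
  note [measurable] = martingaleD(4)[OF f] martingaleD(4)[OF g]
  define X where "X n x = \<bar>f n x\<bar> + e" for n x
  have Xe: "e \<le> X n x" for n x by (simp add: X_def)
  have X0: "0 < X n x" for n x using Xe e by (meson less_le_trans)
  define B where "B n x \<longleftrightarrow> (\<forall>j\<le>n. \<bar>g j x\<bar> < 1)" for n x
  have B_meas: "Measurable.pred (F n) (B n)" for n
  proof -
    have "Measurable.pred (F n) (\<lambda>x. \<bar>g j x\<bar> < 1)" if "j \<le> n" for j
      using martingale_measurable_le[OF g that] by measurable
    then have "Measurable.pred (F n) (\<lambda>x. \<forall>j\<in>{..n}. \<bar>g j x\<bar> < 1)"
      by (intro pred_intros_finite) auto
    moreover have "B n = (\<lambda>x. \<forall>j\<in>{..n}. \<bar>g j x\<bar> < 1)" by (auto simp: B_def)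
    ultimately show ?thesis by (simp only:)
  qed
  have Bg: "\<bar>g n x\<bar> < 1" if "B n x" for n x using that by (simp add: B_def)
  have fg_F: "f n \<in> borel_measurable (F n)" "g n \<in> borel_measurable (F n)" for n
    using martingaleD(2)[OF f] martingaleD(2)[OF g] by auto
  have X_F: "X n \<in> borel_measurable (F n)" for n
    unfolding X_def using fg_F(1)[of n] by measurable
  have meas_M: "h \<in> borel_measurable M" if "h \<in> borel_measurable (F n)" for h :: "'a \<Rightarrow> real" and n
    using that by (rule measurable_from_subalg[OF martingaleD(1)[OF f]])
  \<comment> \<open>Once \<open>\<bar>g\<bar>\<close> has reached 1, the potential is the concave
    function \<open>1 - K * X powr p\<close> of the shifted martingale, and \<open>R\<close> is its
    derivative.\<close>
  define W where "W n x = (if B n x then U (X n x) (g n x) else 1 - K * X n x powr p)" for n x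
  define R where "R n x = (if B n x then P (X n x) (g n x) else - (K * p * X n x powr (p - 1)))" for n x
  define S where "S n x = (if B n x then Q (X n x) (g n x) else 0)" for n x
  have WRS_F: "W n \<in> borel_measurable (F n)" "R n \<in> borel_measurable (F n)" "S n \<in> borel_measurable (F n)" for n
  proof -
    note [measurable] = B_meas[of n] X_F[of n]
      meas[OF X_F fg_F(2), THEN conjunct1, of n] meas[OF X_F fg_F(2), THEN conjunct2, THEN conjunct1, of n]
      meas[OF X_F fg_F(2), THEN conjunct2, THEN conjunct2, of n]
    show "W n \<in> borel_measurable (F n)" unfolding W_def by measurable
    show "R n \<in> borel_measurable (F n)" unfolding R_def by measurable
    show "S n \<in> borel_measurable (F n)" unfolding S_def by measurable
  qed
  \<comment> \<open>A common majorant of all terms: \<open>1 \<le> Y\<close> and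
    \<open>2 \<le> p\<close> give \<open>Y * Y \<le> Y powr p\<close>, so quadratic growth is
    integrable.\<close>
  define Y where "Y n x = 1 + X n x + X (Suc n) x" for n x
  have Y: "1 \<le> Y n x" "X n x \<le> Y n x" "1 + X n x \<le> Y n x" "\<bar>f (Suc n) x - f n x\<bar> \<le> Y n x" for n x
    using X0[of n x] X0[of "Suc n" x] e by (auto simp: Y_def X_def)
  have Y_int: "integrable M (\<lambda>x. c * Y n x powr p)" for c n
  proof -
    have "integrable M (\<lambda>x. ((1 + 2 * e) + \<bar>f n x\<bar> + \<bar>f (Suc n) x\<bar>) powr p)"
      by (rule powr_sum_integrable[OF M]) (use p e fp in auto)
    also have "(\<lambda>x. ((1 + 2 * e) + \<bar>f n x\<bar> + \<bar>f (Suc n) x\<bar>) powr p) = (\<lambda>x. Y n x powr p)"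
      by (simp add: Y_def X_def algebra_simps)
    finally show ?thesis by (rule integrable_mult_right)
  qed
  have Y2: "Y n x * Y n x \<le> Y n x powr p" for n x
    using powr_mono[OF p Y(1)[of n x]] Y(1)[of n x] by (simp add: power2_eq_square)
  have Y1: "1 \<le> Y n x powr p" "X n x powr p \<le> Y n x powr p" "X n x powr (p - 1) * Y n x \<le> Y n x powr p" for n x
  proof -
    show "1 \<le> Y n x powr p" using Y(1) p by (intro ge_one_powr_ge_zero) auto
    show "X n x powr p \<le> Y n x powr p" using Y(2) X0[of n x] p by (intro powr_mono2) auto
    have "X n x powr (p - 1) * Y n x \<le> Y n x powr (p - 1) * Y n x"
      using Y(1,2)[of n x] X0[of n x] p by (intro mult_right_mono powr_mono2) auto
    then show "X n x powr (p - 1) * Y n x \<le> Y n x powr p" using Y(1)[of n x] by (simp add: powr_diff)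
  qed
  have W_bound: "\<bar>W n x\<bar> \<le> (C + 1 + K) * Y n x powr p" for n x
  proof (cases "B n x")
    case True
    have "\<bar>W n x\<bar> \<le> C * (1 + X n x)\<^sup>2" using bound[OF Xe Bg[OF True]] True by (simp add: W_def)
    also have "\<dots> \<le> C * (Y n x * Y n x)" unfolding power2_eq_square
      using Y(3)[of n x] X0[of n x] C by (intro mult_left_mono mult_mono) auto
    also have "\<dots> \<le> C * Y n x powr p" using Y2 C by (intro mult_left_mono) auto
    also have "\<dots> \<le> (C + 1 + K) * Y n x powr p" using K by (intro mult_right_mono) auto
    finally show ?thesis .
  next
    case False
    have "K * X n x powr p \<le> K * Y n x powr p" "0 \<le> K * X n x powr p" "0 \<le> C * Y n x powr p"
      using Y1(2) K C by (auto intro: mult_left_mono)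
    then have "\<bar>1 - K * X n x powr p\<bar> \<le> C * Y n x powr p + Y n x powr p + K * Y n x powr p"
      using Y1(1)[of n x] by linarith
    then show ?thesis using False by (simp add: W_def algebra_simps)
  qed
  have Wi: "integrable M (W n)" for n
    by (rule Bochner_Integration.integrable_bound[OF Y_int[of "C + 1 + K" n]])
      (use W_bound K C meas_M[OF WRS_F(1)] in \<open>auto intro!: AE_I2 simp: abs_mult\<close>)
  have CY: "C * (1 + X n x) * Y n x \<le> C * Y n x powr p" for n x
  proof -
    have "C * ((1 + X n x) * Y n x) \<le> C * (Y n x * Y n x)"
      using Y(1,3)[of n x] C by (intro mult_left_mono mult_right_mono) auto
    also have "\<dots> \<le> C * Y n x powr p" using Y2 C by (intro mult_left_mono) auto
    finally show ?thesis by (simp add: mult.assoc)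
  qed
  have Ri: "integrable M (\<lambda>x. R n x * (f (Suc n) x - f n x))" for n
  proof (rule Bochner_Integration.integrable_bound[OF Y_int[of "C + K * p" n]])
    show "(\<lambda>x. R n x * (f (Suc n) x - f n x)) \<in> borel_measurable M"
      using meas_M[OF WRS_F(2)[of n]] by measurable
    have "\<bar>R n x * (f (Suc n) x - f n x)\<bar> \<le> (C + K * p) * Y n x powr p" for x
    proof (cases "B n x")
      case True
      have "\<bar>R n x * (f (Suc n) x - f n x)\<bar> \<le> C * (1 + X n x) * Y n x" unfolding abs_mult
        using bound[OF Xe Bg[OF True]] True Y(4)[of n x] C X0[of n x] by (intro mult_mono) (auto simp: R_def)
      also have "\<dots> \<le> C * Y n x powr p" by (rule CY)
      also have "\<dots> \<le> (C + K * p) * Y n x powr p" using K p by (intro mult_right_mono) auto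
      finally show ?thesis .
    next
      case False
      have "\<bar>R n x * (f (Suc n) x - f n x)\<bar> \<le> K * p * X n x powr (p - 1) * Y n x" unfolding abs_mult
        using False Y(4)[of n x] K p by (intro mult_mono) (auto simp: R_def abs_mult)
      also have "\<dots> = K * p * (X n x powr (p - 1) * Y n x)" by simp
      also have "\<dots> \<le> K * p * Y n x powr p" using Y1(3) K p by (intro mult_left_mono) auto
      also have "\<dots> \<le> (C + K * p) * Y n x powr p" using C by (intro mult_right_mono) auto
      finally show ?thesis .
    qed
    then show "AE x in M. norm (R n x * (f (Suc n) x - f n x)) \<le> norm ((C + K * p) * Y n x powr p)"
      using K C p by (intro AE_I2) (simp add: abs_mult)
  qed
  have Si: "integrable M (\<lambda>x. S n x * (g (Suc n) x - g n x))" for n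
  proof (rule Bochner_Integration.integrable_bound[OF Y_int[of C n]])
    show "(\<lambda>x. S n x * (g (Suc n) x - g n x)) \<in> borel_measurable M"
      using meas_M[OF WRS_F(3)[of n]] by measurable
    show "AE x in M. norm (S n x * (g (Suc n) x - g n x)) \<le> norm (C * Y n x powr p)"
      using subordinateD(2)[OF sub, of n]
    proof eventually_elim
      case (elim x)
      have "\<bar>S n x\<bar> \<le> C * (1 + X n x)" using bound[OF Xe Bg, of n x] C X0[of n x] by (auto simp: S_def)
      then have "\<bar>S n x * (g (Suc n) x - g n x)\<bar> \<le> C * (1 + X n x) * Y n x" unfolding abs_mult
        using elim Y(4)[of n x] C X0[of n x] by (intro mult_mono) auto
      also note CY
      finally show ?case using C by (simp add: abs_mult)
    qed
  qed
  have sp: "space M \<in> sets (F 0)" using martingaleD(1)[OF f, of 0] by (metis sets.top subalgebra_def)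
  have "(\<integral>x\<in>space M. W n x \<partial>M) \<le> (\<integral>x\<in>space M. W 0 x \<partial>M)"
  proof (rule potential_decreasing[OF M f g sp Wi WRS_F(2,3) Ri Si])
    fix n
    show "AE x in M. W (Suc n) x \<le> W n x + R n x * (f (Suc n) x - f n x) + S n x * (g (Suc n) x - g n x)"
      using f0[of n] f0[of "Suc n"] subordinateD(2)[OF sub, of n]
    proof eventually_elim
      case (elim x)
      have BS: "B (Suc n) x \<longleftrightarrow> B n x \<and> \<bar>g (Suc n) x\<bar> < 1"
        by (auto simp: B_def le_Suc_eq)
      have d: "f (Suc n) x - f n x = X (Suc n) x - X n x" using elim by (simp add: X_def)
      show ?case
      proof (cases "B n x")
        case True
        then show ?thesis using tangent[OF Xe Xe Bg[OF True], of "g (Suc n) x" "Suc n" x] elim(3) BS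
          by (simp add: W_def R_def S_def d)
      next
        case False
        have "K * (X n x powr p + p * X n x powr (p - 1) * (X (Suc n) x - X n x)) \<le> K * X (Suc n) x powr p"
          using p K X0[of n x] X0[of "Suc n" x] by (intro mult_left_mono powr_ge_tangent_at) auto
        then show ?thesis using False BS by (simp add: W_def R_def S_def d algebra_simps)
      qed
    qed
  qed
  then have "(\<integral>x. W n x \<partial>M) \<le> (\<integral>x. W 0 x \<partial>M)" using set_integral_space[OF Wi] by simp
  also have "\<dots> \<le> 0"
  proof -
    have "AE x in M. W 0 x \<le> 0"
      using f0[of 0] subordinateD(1)[OF sub]
    proof eventually_elim
      case (elim x)
      have gX: "\<bar>g 0 x\<bar> \<le> X 0 x" using elim e by (simp add: X_def)
      show ?case
      proof (cases "B 0 x")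
        case True then show ?thesis using start[OF Xe Bg[OF True] gX] by (simp add: W_def)
      next
        case False
        then have "1 \<le> X 0 x" using gX by (simp add: B_def)
        then have "1 * 1 \<le> K * X 0 x powr p" using K p by (intro mult_mono ge_one_powr_ge_zero) auto
        then show ?thesis using False by (simp add: W_def)
      qed
    qed
    then have "0 \<le> (\<integral>x. - W 0 x \<partial>M)" by (intro integral_nonneg_AE) auto
    then show ?thesis by simp
  qed
  finally have W0: "(\<integral>x. W n x \<partial>M) \<le> 0" .
  define E where "E = {x \<in> space M. \<exists>j\<le>n. 1 \<le> \<bar>g j x\<bar>}"
  have [measurable]: "E \<in> sets M" unfolding E_def by measurable
  have iE: "integrable M (indicator E :: 'a \<Rightarrow> real)"
    by (intro integrable_real_indicator) (auto simp: less_top[symmetric])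
  have iX: "integrable M (\<lambda>x. K * X n x powr p)"
  proof (rule Bochner_Integration.integrable_bound[OF Y_int[of K n]])
    have [measurable]: "X n \<in> borel_measurable M" by (rule meas_M[OF X_F])
    show "(\<lambda>x. K * X n x powr p) \<in> borel_measurable M" by measurable
    show "AE x in M. norm (K * X n x powr p) \<le> norm (K * Y n x powr p)"
      using Y1(2) K by (intro AE_I2) (simp add: abs_mult)
  qed
  have "measure M E - (\<integral>x. K * X n x powr p \<partial>M) = (\<integral>x. indicator E x - K * X n x powr p \<partial>M)"
    using iE iX by simp
  also have "\<dots> \<le> (\<integral>x. W n x \<partial>M)"
  proof (rule integral_mono)
    fix x assume x: "x \<in> space M"
    show "indicator E x - K * X n x powr p \<le> W n x"
    proof (cases "B n x")
      case True
      then have "x \<notin> E" by (force simp: B_def E_def)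
      then show ?thesis using True lower[OF Xe Bg[OF True]] by (simp add: W_def)
    next
      case False
      then show ?thesis by (simp add: W_def indicator_def)
    qed
  qed (use iE iX Wi in auto)
  finally show ?thesis using W0 by (simp add: E_def X_def)
qed

lemma integral_powr_shift_limit:
  fixes u :: "'a \<Rightarrow> real"
  assumes M: "prob_space M" and p: "0 < p" and [measurable]: "u \<in> borel_measurable M"
    and u: "integrable M (\<lambda>x. \<bar>u x\<bar> powr p)"
    and le: "\<And>e. 0 < e \<Longrightarrow> c \<le> K * (\<integral>x. (\<bar>u x\<bar> + e) powr p \<partial>M)"
  shows "c \<le> K * (\<integral>x. \<bar>u x\<bar> powr p \<partial>M)"
proof -
  have e: "0 < inverse (real (Suc k))" "inverse (real (Suc k)) \<le> 1" for k by (auto simp: inverse_eq_divide)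
  have "(\<lambda>k. \<integral>x. (\<bar>u x\<bar> + inverse (real (Suc k))) powr p \<partial>M) \<longlonglongrightarrow> (\<integral>x. \<bar>u x\<bar> powr p \<partial>M)"
  proof (rule integral_dominated_convergence)
    show "integrable M (\<lambda>x. (1 + \<bar>u x\<bar> + \<bar>u x\<bar>) powr p)"
      by (rule powr_sum_integrable[OF M p]) (use u in auto)
    show "AE x in M. (\<lambda>k. (\<bar>u x\<bar> + inverse (real (Suc k))) powr p) \<longlonglongrightarrow> \<bar>u x\<bar> powr p"
    proof (rule AE_I2)
      fix x
      have "(\<lambda>k. \<bar>u x\<bar> + inverse (real (Suc k))) \<longlonglongrightarrow> \<bar>u x\<bar> + 0"
        by (intro tendsto_add tendsto_const LIMSEQ_inverse_real_of_nat)
      then show "(\<lambda>k. (\<bar>u x\<bar> + inverse (real (Suc k))) powr p) \<longlonglongrightarrow> \<bar>u x\<bar> powr p"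
        using p e(1) by (intro tendsto_powr2 tendsto_const always_eventually) (auto simp: less_imp_le add_nonneg_nonneg)
    qed
    show "AE x in M. norm ((\<bar>u x\<bar> + inverse (real (Suc k))) powr p) \<le> (1 + \<bar>u x\<bar> + \<bar>u x\<bar>) powr p" for k
    proof (rule AE_I2)
      fix x
      have "\<bar>u x\<bar> + inverse (real (Suc k)) \<le> 1 + \<bar>u x\<bar> + \<bar>u x\<bar>" using e(2)[of k] by linarith
      then show "norm ((\<bar>u x\<bar> + inverse (real (Suc k))) powr p) \<le> (1 + \<bar>u x\<bar> + \<bar>u x\<bar>) powr p"
        using p e(1)[of k] by (auto intro!: powr_mono2)
    qed
  qed simp_all
  then have "(\<lambda>k. K * (\<integral>x. (\<bar>u x\<bar> + inverse (real (Suc k))) powr p \<partial>M)) \<longlonglongrightarrow> K * (\<integral>x. \<bar>u x\<bar> powr p \<partial>M)"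
    by (rule tendsto_mult_left)
  then show ?thesis by (rule LIMSEQ_le_const) (use le e in auto)
qed

lemma weak_type_large_exponent:
  fixes M :: "'a measure"
  assumes M: "prob_space M" and f: "is_martingale M F f" and g: "is_martingale M F g"
    and f0: "\<And>n. AE x in M. f n x \<ge> 0" and sub: "diff_subordinate M g f"
    and p2: "2 \<le> p" and fp: "\<And>n. integrable M (\<lambda>x. \<bar>f n x\<bar> powr p)"
  shows "measure M {x \<in> space M. \<exists>j\<le>n. 1 \<le> \<bar>g j x\<bar>} \<le> (p / 2) powr p / (p - 1) * (\<integral>x. \<bar>f n x\<bar> powr p \<partial>M)"
proof (rule integral_powr_shift_limit[OF M _ martingaleD(4)[OF f] fp])
  fix e :: real assume e: "0 < e"
  show "measure M {x \<in> space M. \<exists>j\<le>n. 1 \<le> \<bar>g j x\<bar>} \<le> (p / 2) powr p / (p - 1) * (\<integral>x. (\<bar>f n x\<bar> + e) powr p \<partial>M)"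
  \<comment> \<open>For \<open>p = 2\<close> one has \<open>\<beta> = 0\<close> and the constant is
    1; the ray becomes the diagonal, and \<open>y^2 - x^2\<close> alone serves as special
    function.\<close>
  proof (cases "p = 2")
    case True
    have "measure M {x \<in> space M. \<exists>j\<le>n. 1 \<le> \<bar>g j x\<bar>} \<le> 1 * (\<integral>x. (\<bar>f n x\<bar> + e) powr p \<partial>M)"
    proof (rule bellman_weak_type[OF M f g f0 sub p2 e _ _ fp, where U="\<lambda>x y. y\<^sup>2 - x\<^sup>2" and P="\<lambda>x y. - 2 * x"
          and Q="\<lambda>x y. 2 * y" and C=2])
      fix x y x' y' :: real assume a: "e \<le> x" "e \<le> x'" "\<bar>y\<bar> < 1" "\<bar>y' - y\<bar> \<le> \<bar>x' - x\<bar>"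
      have "(y' - y)\<^sup>2 \<le> (x' - x)\<^sup>2" using a(4) by (simp add: abs_le_square_iff)
      then have "y'\<^sup>2 - x'\<^sup>2 \<le> y\<^sup>2 - x\<^sup>2 + - 2 * x * (x' - x) + 2 * y * (y' - y)"
        by (simp add: algebra_simps power2_eq_square)
      moreover have "1 \<le> y'\<^sup>2" if "\<not> \<bar>y'\<bar> < 1" using that power_mono[of 1 "\<bar>y'\<bar>" 2] by simp
      ultimately show "(if \<bar>y'\<bar> < 1 then y'\<^sup>2 - x'\<^sup>2 else 1 - 1 * x' powr p)
          \<le> y\<^sup>2 - x\<^sup>2 + - 2 * x * (x' - x) + 2 * y * (y' - y)"
        using True a e by auto
    next
      fix x y :: real assume a: "e \<le> x" "\<bar>y\<bar> < 1"
      then have x: "0 < x" using e by simp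
      show "- (1 * x powr p) \<le> y\<^sup>2 - x\<^sup>2" using x True by simp
      show "y\<^sup>2 - x\<^sup>2 \<le> 0" if "\<bar>y\<bar> \<le> x" using that by (simp add: abs_le_square_iff[symmetric])
      have "y\<^sup>2 \<le> 1" using a by (simp add: abs_square_le_1)
      then show "\<bar>y\<^sup>2 - x\<^sup>2\<bar> \<le> 2 * (1 + x)\<^sup>2 \<and> \<bar>- 2 * x\<bar> \<le> 2 * (1 + x) \<and> \<bar>2 * y\<bar> \<le> 2 * (1 + x)"
      proof -
        have "2 * (1 + x)\<^sup>2 = 2 + 4 * x + 2 * x\<^sup>2" by (simp add: algebra_simps power2_eq_square)
        then have "\<bar>y\<^sup>2 - x\<^sup>2\<bar> \<le> 2 * (1 + x)\<^sup>2"
          using x \<open>y\<^sup>2 \<le> 1\<close> zero_le_power2[of y] zero_le_power2[of x] by linarith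
        then show ?thesis using x a by auto
      qed
    qed auto
    then show ?thesis using True by simp
  next
    case False
    interpret bellman p "p\<^sup>2 / (2 * (p - 1))" "1 - 2 / p" using p2 False by unfold_locales auto
    \<comment> \<open>At the point \<open>(1, 1)\<close> the majorization and the sign on
      \<open>c \<le> 0\<close> combine to \<open>1 - K \<le> U 2 0 \<le> 0\<close>.\<close>
    have K: "1 \<le> K"
      using U_ge_outside[of 1 1] U_nonpos[of 2 0] by simp
    obtain C where C: "\<And>x y. e \<le> x \<Longrightarrow> \<bar>y\<bar> < 1 \<Longrightarrow>
      \<bar>V x y\<bar> \<le> C * (1 + x)\<^sup>2 \<and> \<bar>Vx x y\<bar> \<le> C * (1 + x) \<and> \<bar>Vy x y\<bar> \<le> C * (1 + x)"
      using V_bounds[OF e] by blast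
    have C0: "0 \<le> C"
    proof -
      have "0 \<le> C * (1 + e)" using C[of e 0] by (smt (verit))
      then show ?thesis using e by (simp add: zero_le_mult_iff)
    qed
    have "measure M {x \<in> space M. \<exists>j\<le>n. 1 \<le> \<bar>g j x\<bar>} \<le> K * (\<integral>x. (\<bar>f n x\<bar> + e) powr p \<partial>M)"
    proof (rule bellman_weak_type[OF M f g f0 sub p2 e K C0 fp, where U=V and P=Vx and Q=Vy])
      fix x y x' y' :: real assume a: "e \<le> x" "e \<le> x'" "\<bar>y\<bar> < 1" "\<bar>y' - y\<bar> \<le> \<bar>x' - x\<bar>"
      then have x: "0 < x" "0 < x'" using e by auto
      have "1 - K * x' powr p \<le> V x' y'" if "\<not> \<bar>y'\<bar> < 1"
        using U_ge_outside[of x' "\<bar>y'\<bar>"] that x by (simp add: V_def)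
      then show "(if \<bar>y'\<bar> < 1 then V x' y' else 1 - K * x' powr p) \<le> V x y + Vx x y * (x' - x) + Vy x y * (y' - y)"
        using V_tangent[OF x a(4)] by (auto intro: order_trans)
    next
      fix x y :: real assume a: "e \<le> x" "\<bar>y\<bar> < 1"
      then have x: "0 < x" using e by simp
      show "- (K * x powr p) \<le> V x y" using U_ge[of x "\<bar>y\<bar>"] x a by (simp add: V_def)
      show "V x y \<le> 0" if "\<bar>y\<bar> \<le> x" using U_nonpos[of "x + \<bar>y\<bar>" "\<bar>y\<bar> - x"] that x by (simp add: V_def)
    qed (use C V_measurable in auto)
    then show ?thesis by (simp add: K_def)
  qed
qed (use p2 in auto)

section \<open>From level 1 and finite time to the norms\<close>

lemma mart_norm_finiteD:
  assumes p: "0 < p" and [measurable]: "f n \<in> borel_measurable M" and fin: "mart_norm M p f \<noteq> \<top>"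
  shows "integrable M (\<lambda>x. \<bar>f n x\<bar> powr p)"
    "(\<integral>x. \<bar>f n x\<bar> powr p \<partial>M) \<le> enn2real (mart_norm M p f) powr p"
proof -
  define I where "I = (\<integral>\<^sup>+ x. ennreal (\<bar>f n x\<bar> powr p) \<partial>M)"
  have le: "epowr I (1 / p) \<le> mart_norm M p f"
    unfolding mart_norm_def I_def by (rule SUP_upper) simp
  then have I: "I \<noteq> \<top>" using fin by (auto simp: epowr_def top_unique split: if_splits)
  show int: "integrable M (\<lambda>x. \<bar>f n x\<bar> powr p)"
    by (rule integrableI_nonneg) (use I in \<open>auto simp: I_def less_top\<close>)
  have Ii: "I = ennreal (\<integral>x. \<bar>f n x\<bar> powr p \<partial>M)"
    unfolding I_def by (rule nn_integral_eq_integral[OF int]) simp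
  have nn: "0 \<le> (\<integral>x. \<bar>f n x\<bar> powr p \<partial>M)" by simp
  have "ennreal ((\<integral>x. \<bar>f n x\<bar> powr p \<partial>M) powr (1 / p)) \<le> mart_norm M p f"
    using le nn by (simp add: epowr_def Ii)
  then have "(\<integral>x. \<bar>f n x\<bar> powr p \<partial>M) powr (1 / p) \<le> enn2real (mart_norm M p f)"
    using fin by (metis enn2real_ennreal enn2real_mono less_top powr_ge_zero)
  then have "((\<integral>x. \<bar>f n x\<bar> powr p \<partial>M) powr (1 / p)) powr p \<le> enn2real (mart_norm M p f) powr p"
    using p by (intro powr_mono2) auto
  then show "(\<integral>x. \<bar>f n x\<bar> powr p \<partial>M) \<le> enn2real (mart_norm M p f) powr p"
    using p nn by (simp add: powr_powr)
qed

text \<open>The supremum in \<open>maxfun\<close> need not be attained, so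
  \<open>maxfun g x \<ge> l\<close> does not put some \<open>\<bar>g n x\<bar>\<close> above
  \<open>l\<close>. Every smaller level is reached at a finite time, and the bound is continuous in
  the level.\<close>

lemma weak_norm_le:
  assumes M: "prob_space M" and [measurable]: "\<And>n. g n \<in> borel_measurable M" and p: "0 < p" and c: "0 \<le> c"
    and bd: "\<And>n l. 0 < l \<Longrightarrow> measure M {x \<in> space M. \<exists>j\<le>n. l \<le> \<bar>g j x\<bar>} \<le> (c / l) powr p"
  shows "weak_norm M p g \<le> ennreal c"
  unfolding weak_norm_def
proof (rule SUP_least)
  interpret prob_space M by fact
  fix l :: real assume "l \<in> {0<..}"
  then have l: "0 < l" by simp
  let ?A = "{x \<in> space M. ennreal l \<le> maxfun g x}"
  have "measure M ?A \<le> (c / l') powr p" if l': "0 < l'" "l' < l" for l'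
  proof -
    define E where "E n = {x \<in> space M. \<exists>j\<le>n. l' \<le> \<bar>g j x\<bar>}" for n
    have [measurable]: "E n \<in> sets M" for n unfolding E_def by measurable
    have "?A \<subseteq> (\<Union>n. E n)"
    proof
      fix x assume x: "x \<in> ?A"
      have "ennreal l' < ennreal l" using l' by (simp add: ennreal_less_iff)
      also have "\<dots> \<le> maxfun g x" using x by simp
      finally obtain n where "ennreal l' < ennreal \<bar>g n x\<bar>" by (auto simp: maxfun_def less_SUP_iff)
      then have "l' \<le> \<bar>g n x\<bar>" using l' by (simp add: ennreal_less_iff)
      then show "x \<in> (\<Union>n. E n)" using x by (auto simp: E_def)
    qed
    then have "measure M ?A \<le> measure M (\<Union>n. E n)" by (intro finite_measure_mono) auto
    moreover have "(\<lambda>n. measure M (E n)) \<longlonglongrightarrow> measure M (\<Union>n. E n)"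
      by (rule finite_Lim_measure_incseq) (auto simp: incseq_def E_def intro: order_trans)
    then have "measure M (\<Union>n. E n) \<le> (c / l') powr p"
      by (rule LIMSEQ_le_const2) (use bd[OF l'(1)] in \<open>auto simp: E_def\<close>)
    ultimately show ?thesis by simp
  qed
  then have ev: "eventually (\<lambda>l'. measure M ?A \<le> (c / l') powr p) (at_left l)"
    using l by (intro eventually_at_leftI[of 0]) auto
  have "((\<lambda>l'. (c / l') powr p) \<longlongrightarrow> (c / l) powr p) (at_left l)"
  proof (rule tendsto_powr2)
    show "((\<lambda>l'. c / l') \<longlongrightarrow> c / l) (at_left l)" using l by (intro tendsto_intros) auto
    show "\<forall>\<^sub>F l' in at_left l. 0 \<le> c / l'" using l c by (intro eventually_at_leftI[of 0]) auto
  qed (use p in auto)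
  then have "measure M ?A \<le> (c / l) powr p"
    by (rule tendsto_lowerbound[OF _ ev]) simp
  then have "measure M ?A powr (1 / p) \<le> ((c / l) powr p) powr (1 / p)"
    using p by (intro powr_mono2) auto
  also have "\<dots> = c / l" using p c l by (simp add: powr_powr)
  finally have "l * measure M ?A powr (1 / p) \<le> c" using l by (simp add: field_simps)
  then show "ennreal l * epowr (emeasure M ?A) (1 / p) \<le> ennreal c"
    using l c by (simp add: emeasure_eq_measure epowr_def ennreal_mult'[symmetric] ennreal_leI)
qed

text \<open>Dividing by \<open>l\<close> reduces every level to 1. The index \<open>k\<close> is
  left open because small exponents compare with \<open>f 0\<close> and large ones with
  \<open>f n\<close>.\<close>

lemma weak_norm_le_mart_norm:
  assumes M: "prob_space M" and f: "is_martingale M F f" and g: "is_martingale M F g"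
    and p: "0 < p" and c: "0 < c"
    and bd: "\<And>n l. 0 < l \<Longrightarrow> (\<And>n. integrable M (\<lambda>x. \<bar>f n x\<bar> powr p)) \<Longrightarrow>
      \<exists>k. measure M {x \<in> space M. \<exists>j\<le>n. 1 \<le> \<bar>g j x / l\<bar>} \<le> c powr p * (\<integral>x. \<bar>f k x / l\<bar> powr p \<partial>M)"
  shows "weak_norm M p g \<le> ennreal c * mart_norm M p f"
proof (cases "mart_norm M p f = \<top>")
  case True
  then show ?thesis using c by (simp add: ennreal_mult_top)
next
  case False
  define m where "m = enn2real (mart_norm M p f)"
  have m: "mart_norm M p f = ennreal m" "0 \<le> m" using False by (auto simp: m_def less_top)
  note fin = mart_norm_finiteD[OF p martingaleD(4)[OF f] False]
  have "weak_norm M p g \<le> ennreal (c * m)"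
  proof (rule weak_norm_le[OF M martingaleD(4)[OF g] p])
    fix n and l :: real assume l: "0 < l"
    then obtain k where k: "measure M {x \<in> space M. \<exists>j\<le>n. 1 \<le> \<bar>g j x / l\<bar>} \<le> c powr p * (\<integral>x. \<bar>f k x / l\<bar> powr p \<partial>M)"
      using bd fin(1) by blast
    have "(\<integral>x. \<bar>f k x / l\<bar> powr p \<partial>M) = (\<integral>x. \<bar>f k x\<bar> powr p \<partial>M) / l powr p"
      using l by (simp add: abs_divide powr_divide)
    also have "\<dots> \<le> m powr p / l powr p" using fin(2)[of k] by (intro divide_right_mono) (auto simp: m_def)
    finally have "c powr p * (\<integral>x. \<bar>f k x / l\<bar> powr p \<partial>M) \<le> c powr p * (m powr p / l powr p)"
      by (intro mult_left_mono) auto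
    also have "\<dots> = (c * m / l) powr p" using c m l by (simp add: powr_mult powr_divide)
    finally show "measure M {x \<in> space M. \<exists>j\<le>n. l \<le> \<bar>g j x\<bar>} \<le> (c * m / l) powr p"
      using k l by (simp add: abs_divide le_divide_eq)
  qed (use c m in auto)
  then show ?thesis using c m by (simp add: ennreal_mult)
qed

lemma weak_norm_bounds:
  assumes M: "prob_space M" and f: "is_martingale M F f" and g: "is_martingale M F g"
    and f0: "\<forall>n. AE x in M. f n x \<ge> 0" and sub: "diff_subordinate M g f"
  shows "0 < p \<Longrightarrow> p < 1 \<Longrightarrow> weak_norm M p g \<le> ennreal 2 * mart_norm M p f"
    and "2 \<le> p \<Longrightarrow> weak_norm M p g \<le> ennreal (p / 2 * (p - 1) powr (- 1 / p)) * mart_norm M p f"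
proof -
  have sc: "is_martingale M F (\<lambda>n x. f n x / l)" "is_martingale M F (\<lambda>n x. g n x / l)"
    "\<And>n. AE x in M. f n x / l \<ge> 0" "diff_subordinate M (\<lambda>n x. g n x / l) (\<lambda>n x. f n x / l)"
    if "0 < l" for l
  proof -
    show "is_martingale M F (\<lambda>n x. f n x / l)" "is_martingale M F (\<lambda>n x. g n x / l)"
      "diff_subordinate M (\<lambda>n x. g n x / l) (\<lambda>n x. f n x / l)"
      using that martingale_scale[OF f] martingale_scale[OF g] subordinate_scale[OF sub] by auto
    show "AE x in M. f n x / l \<ge> 0" for n
      using f0[rule_format, of n] that by (auto elim!: eventually_mono)
  qed
  show "weak_norm M p g \<le> ennreal 2 * mart_norm M p f" if p: "0 < p" "p < 1"
  proof (rule weak_norm_le_mart_norm[OF M f g p(1)])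
    fix n and l :: real assume l: "0 < l"
    have "measure M {x \<in> space M. \<exists>j\<le>n. 1 \<le> \<bar>g j x / l\<bar>} \<le> (\<integral>x. \<bar>2 * (f 0 x / l)\<bar> powr p \<partial>M)"
      using weak_type_small_exponent[OF M sc[OF l] p(1)] p by simp
    also have "\<dots> = 2 powr p * (\<integral>x. \<bar>f 0 x / l\<bar> powr p \<partial>M)"
      by (simp only: abs_mult powr_mult) simp
    finally show "\<exists>k. measure M {x \<in> space M. \<exists>j\<le>n. 1 \<le> \<bar>g j x / l\<bar>} \<le> 2 powr p * (\<integral>x. \<bar>f k x / l\<bar> powr p \<partial>M)"
      by blast
  qed simp
  show "weak_norm M p g \<le> ennreal (p / 2 * (p - 1) powr (- 1 / p)) * mart_norm M p f" if p: "2 \<le> p"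
  proof (rule weak_norm_le_mart_norm[OF M f g])
    fix n and l :: real assume l: "0 < l" and int: "\<And>n. integrable M (\<lambda>x. \<bar>f n x\<bar> powr p)"
    have "integrable M (\<lambda>x. \<bar>f n x / l\<bar> powr p)" for n
      using int[of n] l by (simp add: abs_divide powr_divide)
    then have "measure M {x \<in> space M. \<exists>j\<le>n. 1 \<le> \<bar>g j x / l\<bar>} \<le> (p / 2) powr p / (p - 1) * (\<integral>x. \<bar>f n x / l\<bar> powr p \<partial>M)"
      by (intro weak_type_large_exponent[OF M sc[OF l] p])
    also have "(p / 2) powr p / (p - 1) = (p / 2 * (p - 1) powr (- 1 / p)) powr p"
    proof -
      have "(p / 2 * (p - 1) powr (- 1 / p)) powr p = (p / 2) powr p * ((p - 1) powr (- 1 / p)) powr p"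
        by (rule powr_mult)
      also have "((p - 1) powr (- 1 / p)) powr p = (p - 1) powr (- 1 / p * p)" by (rule powr_powr)
      also have "- 1 / p * p = - 1" using p by simp
      also have "(p - 1) powr - 1 = 1 / (p - 1)" using p by (simp add: powr_minus_divide)
      finally show ?thesis by simp
    qed
    finally show "\<exists>k. measure M {x \<in> space M. \<exists>j\<le>n. 1 \<le> \<bar>g j x / l\<bar>}
        \<le> (p / 2 * (p - 1) powr (- 1 / p)) powr p * (\<integral>x. \<bar>f k x / l\<bar> powr p \<partial>M)"
      by blast
  qed (use p in auto)
qed

section \<open>Extremal processes\<close>

definition sharpness_witness :: "real \<Rightarrow> real \<Rightarrow> bool" where
  "sharpness_witness q C \<longleftrightarrow> (\<exists>(N :: real measure) G u w. prob_space N \<and> is_martingale N G u \<and> is_martingale N G w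
            \<and> (\<forall>n. AE x in N. u n x \<ge> 0) \<and> is_transform N G u w
            \<and> weak_norm N q w > ennreal C * mart_norm N q u)"

text \<open>A chain that at time \<open>k\<close> is alive with probability \<open>m k\<close> and then sits at \<open>a k\<close>; if it dies at step
  \<open>k\<close> it jumps to \<open>d k\<close> and stays there. The transform multiplies its \<open>k\<close>-th increment by \<open>v k\<close>.
  A sample point is the number of steps survived, capped at \<open>L\<close>.\<close>
locale dying_chain =
  fixes a d m v :: "nat \<Rightarrow> real" and L :: nat
  assumes m0: "m 0 = 1" and m_dec: "\<And>k. m (Suc k) \<le> m k" and m_nonneg: "\<And>k. 0 \<le> m k"
    and a_nonneg: "\<And>k. 0 \<le> a k" and d_nonneg: "\<And>k. 0 \<le> d k"
    and balance: "\<And>k. k < L \<Longrightarrow> m k * a k = m (Suc k) * a (Suc k) + (m k - m (Suc k)) * d (Suc k)"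
    and v_le: "\<And>k. \<bar>v k\<bar> \<le> 1"
begin

definition wt :: "nat \<Rightarrow> real" where
  "wt j = (if j < L then m j - m (Suc j) else if j = L then m L else 0)"

lemma wt_nonneg: "0 \<le> wt j"
  using m_dec m_nonneg by (simp add: wt_def)

lemma wt_tail: "n \<le> L \<Longrightarrow> (\<Sum>j=n..L. wt j) = m n"
proof (induction rule: inc_induct)
  case base then show ?case by (simp add: wt_def)
next
  case (step n)
  then have "(\<Sum>j=n..L. wt j) = wt n + (\<Sum>j=Suc n..L. wt j)" by (simp add: sum.atLeast_Suc_atMost)
  then show ?case using step by (simp add: wt_def)
qed

definition law :: "nat pmf" where "law = embed_pmf wt"

lemma pmf_law: "pmf law j = wt j"
  unfolding law_def
proof (rule pmf_embed_pmf)
  have "(\<integral>\<^sup>+ x. ennreal (wt x) \<partial>count_space UNIV) = (\<Sum>j\<in>{0..L}. ennreal (wt j))"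
    by (rule nn_integral_count_space') (auto simp: wt_def)
  also have "\<dots> = ennreal (\<Sum>j\<in>{0..L}. wt j)" using wt_nonneg by (intro sum_ennreal) auto
  finally show "(\<integral>\<^sup>+ x. ennreal (wt x) \<partial>count_space UNIV) = 1" using wt_tail[of 0] m0 by simp
qed (rule wt_nonneg)

text \<open>The law lives on the naturals and is carried to the reals, where the sharpness claim
  wants its examples.\<close>

definition Mn :: "real measure" where "Mn = measure_pmf (map_pmf real law)"

lemma prob_Mn: "prob_space Mn" and space_Mn: "space Mn = UNIV" and sets_Mn: "sets Mn = UNIV"
  by (simp_all add: Mn_def measure_pmf.prob_space_axioms)

lemma set_law: "set_pmf law \<subseteq> {0..L}"
  by (auto simp: set_pmf_iff pmf_law wt_def split: if_splits)

lemma integrable_Mn: "integrable Mn (h :: real \<Rightarrow> real)"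
  unfolding Mn_def by (rule integrable_measure_pmf_finite) (use set_law finite_subset in auto)

lemma integral_Mn: "(\<integral>x. h x \<partial>Mn) = (\<Sum>j=0..L. h (real j) * wt j)" for h :: "real \<Rightarrow> real"
proof -
  have "(\<integral>x. h x \<partial>Mn) = measure_pmf.expectation law (\<lambda>j. h (real j))" by (simp add: Mn_def)
  also have "\<dots> = (\<Sum>j=0..L. h (real j) * pmf law j)"
    by (rule integral_measure_pmf_real) (use set_law in auto)
  finally show ?thesis by (simp add: pmf_law)
qed

definition idx :: "real \<Rightarrow> nat" where "idx x = nat \<lfloor>x\<rfloor>"

lemma idx_real [simp]: "idx (real j) = j" by (simp add: idx_def)

text \<open>Known at time \<open>n\<close>: whether the chain survived \<open>n\<close> steps and,
  if not, when it died.\<close>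

definition G :: "nat \<Rightarrow> real measure" where
  "G n = vimage_algebra UNIV (\<lambda>x. min (idx x) n) (count_space UNIV)"

lemma sets_G: "A \<in> sets (G n) \<longleftrightarrow> (\<exists>S. A = {x. min (idx x) n \<in> S})"
  by (auto simp: G_def sets_vimage_algebra2 vimage_def)

lemma measurable_G: "(\<lambda>x. h (min (idx x) n)) \<in> borel_measurable (G n)" for h :: "nat \<Rightarrow> real"
proof -
  have "(\<lambda>x. min (idx x) n) \<in> G n \<rightarrow>\<^sub>M count_space UNIV"
    unfolding G_def by (rule measurable_vimage_algebra1) auto
  then show ?thesis by (rule measurable_compose) simp
qed

lemma filtration_G: "is_filtration Mn G"
  unfolding is_filtration_def
proof (intro conjI allI impI)
  show "subalgebra Mn (G n)" for n by (auto simp: subalgebra_def space_Mn sets_Mn G_def)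
  fix n k :: nat assume "n \<le> k"
  show "sets (G n) \<subseteq> sets (G k)"
  proof
    fix A assume "A \<in> sets (G n)"
    then obtain S where "A = {x. min (idx x) n \<in> S}" by (auto simp: sets_G)
    then have "A = {x. min (idx x) k \<in> {i. min i n \<in> S}}" using \<open>n \<le> k\<close> by (simp add: min.assoc min_absorb2)
    then show "A \<in> sets (G k)" unfolding sets_G by blast
  qed
qed

text \<open>A sample point \<open>j < L\<close> survives exactly \<open>j\<close> steps and dies at
  step \<open>Suc j\<close>, hence the value \<open>d (Suc j)\<close>; alive at time
  \<open>n \<le> L\<close> means \<open>n \<le> j\<close>.\<close>

definition u :: "nat \<Rightarrow> real \<Rightarrow> real" where
  "u n x = (if min n L \<le> idx x then a (min n L) else d (Suc (idx x)))"

definition b :: "nat \<Rightarrow> real" where "b n = v 0 * a 0 + (\<Sum>k<n. v (Suc k) * (a (Suc k) - a k))"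

definition w :: "nat \<Rightarrow> real \<Rightarrow> real" where
  "w n x = (if min n L \<le> idx x then b (min n L) else b (idx x) + v (Suc (idx x)) * (d (Suc (idx x)) - a (idx x)))"

definition vv :: "nat \<Rightarrow> real" where "vv n = (if n \<le> L then v n else 0)"

lemma u_increment: "u (Suc n) x - u n x =
    (if n < L \<and> n \<le> idx x then (if idx x = n then d (Suc n) else a (Suc n)) - a n else 0)"
  by (auto simp: u_def min_def not_le less_Suc_eq_le not_less_eq_eq)

lemma w_increment: "w (Suc n) x - w n x = vv (Suc n) * (u (Suc n) x - u n x)"
  unfolding u_increment by (auto simp: w_def vv_def b_def min_def not_le less_Suc_eq_le not_less_eq_eq)

lemma u_meas: "u n \<in> borel_measurable (G n)" and w_meas: "w n \<in> borel_measurable (G n)"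
proof -
  have "u n = (\<lambda>x. (\<lambda>j. if min n L \<le> j then a (min n L) else d (Suc j)) (min (idx x) n))"
    by (auto simp: u_def min_def)
  then show "u n \<in> borel_measurable (G n)"
    using measurable_G[of "\<lambda>j. if min n L \<le> j then a (min n L) else d (Suc j)" n] by simp
  have "w n = (\<lambda>x. (\<lambda>j. if min n L \<le> j then b (min n L) else b j + v (Suc j) * (d (Suc j) - a j)) (min (idx x) n))"
    by (auto simp: w_def min_def)
  then show "w n \<in> borel_measurable (G n)"
    using measurable_G[of "\<lambda>j. if min n L \<le> j then b (min n L) else b j + v (Suc j) * (d (Suc j) - a j)" n] by simp
qed

lemma increment_orthogonal:
  assumes "A \<in> sets (G n)"
  shows "(\<integral>x. indicator A x * (u (Suc n) x - u n x) \<partial>Mn) = 0"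
proof (cases "n < L")
  case True
  obtain S where S: "A = {x. min (idx x) n \<in> S}" using assms by (auto simp: sets_G)
  let ?D = "\<lambda>j. (if j = n then d (Suc n) else a (Suc n)) - a n"
  have "(\<integral>x. indicator A x * (u (Suc n) x - u n x) \<partial>Mn)
      = (\<Sum>j=0..L. (if n \<le> j then indicator S n * ?D j * wt j else 0))"
    unfolding integral_Mn u_increment using True by (intro sum.cong) (auto simp: S indicator_def)
  also have "\<dots> = (\<Sum>j=n..L. indicator S n * ?D j * wt j)"
    by (rule sum.mono_neutral_cong_right) auto
  also have "\<dots> = indicator S n * (\<Sum>j=n..L. ?D j * wt j)" by (simp add: sum_distrib_left mult.assoc)
  also have "(\<Sum>j=n..L. ?D j * wt j) = (d (Suc n) - a n) * wt n + (\<Sum>j=Suc n..L. ?D j * wt j)"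
    using True by (simp add: sum.atLeast_Suc_atMost)
  also have "(\<Sum>j=Suc n..L. ?D j * wt j) = (\<Sum>j=Suc n..L. (a (Suc n) - a n) * wt j)"
    by (intro sum.cong) auto
  also have "\<dots> = (a (Suc n) - a n) * m (Suc n)"
    using wt_tail[of "Suc n"] True by (simp add: sum_distrib_left[symmetric])
  also have "(d (Suc n) - a n) * wt n + (a (Suc n) - a n) * m (Suc n) = 0"
    using balance[OF True] True by (simp add: wt_def algebra_simps)
  finally show ?thesis by simp
next
  case False
  then show ?thesis by (simp add: u_increment)
qed

lemma martingale_u: "is_martingale Mn G u"
  unfolding is_martingale_def
proof (intro conjI allI ballI)
  fix n A assume A: "A \<in> sets (G n)"
  have "(\<integral>x. indicator A x * u (Suc n) x \<partial>Mn) - (\<integral>x. indicator A x * u n x \<partial>Mn)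
      = (\<integral>x. indicator A x * (u (Suc n) x - u n x) \<partial>Mn)"
    by (simp add: integrable_Mn right_diff_distrib)
  then show "(\<integral>x\<in>A. u (Suc n) x \<partial>Mn) = (\<integral>x\<in>A. u n x \<partial>Mn)"
    using increment_orthogonal[OF A] by (simp add: set_lebesgue_integral_def)
qed (auto simp: filtration_G u_meas integrable_Mn)

lemma martingale_w: "is_martingale Mn G w"
  unfolding is_martingale_def
proof (intro conjI allI ballI)
  fix n A assume A: "A \<in> sets (G n)"
  have "(\<integral>x. indicator A x * w (Suc n) x \<partial>Mn) - (\<integral>x. indicator A x * w n x \<partial>Mn)
      = (\<integral>x. indicator A x * (w (Suc n) x - w n x) \<partial>Mn)"
    by (simp add: integrable_Mn right_diff_distrib)
  also have "\<dots> = vv (Suc n) * (\<integral>x. indicator A x * (u (Suc n) x - u n x) \<partial>Mn)"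
    by (simp only: w_increment mult.left_commute[of _ "vv (Suc n)"] integral_mult_right_zero)
  finally show "(\<integral>x\<in>A. w (Suc n) x \<partial>Mn) = (\<integral>x\<in>A. w n x \<partial>Mn)"
    using increment_orthogonal[OF A] by (simp add: set_lebesgue_integral_def)
qed (auto simp: filtration_G w_meas integrable_Mn)

lemma transform: "is_transform Mn G u w"
  unfolding is_transform_def
proof (intro exI[of _ "\<lambda>n x. vv n"] conjI allI ballI)
  fix n x
  show "dseq w n x = vv n * dseq u n x"
  proof (cases n)
    case 0 then show ?thesis by (simp add: dseq_def w_def u_def b_def vv_def)
  next
    case (Suc k) then show ?thesis using w_increment[of k x] by (simp add: dseq_def)
  qed
qed (auto simp: vv_def v_le)

lemma integral_u_powr:
  assumes "n \<le> L"
  shows "(\<integral>x. \<bar>u n x\<bar> powr q \<partial>Mn) = (\<Sum>k<n. (m k - m (Suc k)) * d (Suc k) powr q) + m n * a n powr q"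
proof -
  have "(\<integral>x. \<bar>u n x\<bar> powr q \<partial>Mn) = (\<Sum>j=0..L. \<bar>if n \<le> j then a n else d (Suc j)\<bar> powr q * wt j)"
    unfolding integral_Mn using assms by (intro sum.cong) (auto simp: u_def min_absorb1)
  also have "{0..L} = {..<n} \<union> {n..L}" using assms by auto
  also have "(\<Sum>j\<in>{..<n} \<union> {n..L}. \<bar>if n \<le> j then a n else d (Suc j)\<bar> powr q * wt j)
     = (\<Sum>j<n. \<bar>if n \<le> j then a n else d (Suc j)\<bar> powr q * wt j) + (\<Sum>j=n..L. \<bar>if n \<le> j then a n else d (Suc j)\<bar> powr q * wt j)"
    by (rule sum.union_disjoint) auto
  also have "(\<Sum>j<n. \<bar>if n \<le> j then a n else d (Suc j)\<bar> powr q * wt j) = (\<Sum>k<n. (m k - m (Suc k)) * d (Suc k) powr q)"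
    using assms d_nonneg by (intro sum.cong) (auto simp: wt_def)
  also have "(\<Sum>j=n..L. \<bar>if n \<le> j then a n else d (Suc j)\<bar> powr q * wt j) = (\<Sum>j=n..L. a n powr q * wt j)"
    using a_nonneg by (intro sum.cong) auto
  also have "\<dots> = m n * a n powr q" using wt_tail[OF assms] by (simp add: sum_distrib_left[symmetric])
  finally show ?thesis .
qed

text \<open>The atom at \<open>L\<close> has mass \<open>m L\<close>, and \<open>w\<close> reaches
  level 1 in modulus there, so level 1 alone bounds the weak norm from below. Moments up to time
  \<open>L\<close> suffice because \<open>u\<close> is constant afterwards.\<close>

lemma witness:
  assumes q: "0 < q" and C: "0 < C"
    and hit: "1 \<le> \<bar>b L\<bar>"
    and E: "\<And>n. n \<le> L \<Longrightarrow> (\<Sum>k<n. (m k - m (Suc k)) * d (Suc k) powr q) + m n * a n powr q \<le> E"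
    and CE: "C powr q * E < m L"
  shows "sharpness_witness q C"
proof -
  have "a 0 powr q \<le> E" using E[of 0] m0 by simp
  then have E0: "0 \<le> E" using powr_ge_zero[of "a 0" q] by linarith
  have "mart_norm Mn q u \<le> ennreal (E powr (1 / q))"
    unfolding mart_norm_def
  proof (rule SUP_least)
    fix n
    let ?n = "min n L"
    have un: "u n = u ?n" by (auto simp: u_def)
    have "(\<integral>\<^sup>+ x. ennreal (\<bar>u n x\<bar> powr q) \<partial>Mn) = ennreal (\<integral>x. \<bar>u ?n x\<bar> powr q \<partial>Mn)"
      unfolding un by (rule nn_integral_eq_integral) (auto simp: integrable_Mn)
    moreover have "0 \<le> (\<integral>x. \<bar>u ?n x\<bar> powr q \<partial>Mn)" by simp
    moreover have "(\<integral>x. \<bar>u ?n x\<bar> powr q \<partial>Mn) \<le> E" using E[of ?n] integral_u_powr[of ?n q] by simp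
    ultimately show "epowr (\<integral>\<^sup>+ x. ennreal (\<bar>u n x\<bar> powr q) \<partial>Mn) (1 / q) \<le> ennreal (E powr (1 / q))"
      using q by (auto simp: epowr_def intro!: ennreal_leI powr_mono2)
  qed
  then have "ennreal C * mart_norm Mn q u \<le> ennreal C * ennreal (E powr (1 / q))" by (intro mult_left_mono) auto
  also have "\<dots> = ennreal (C * E powr (1 / q))" using C by (simp add: ennreal_mult)
  also have "C * E powr (1 / q) = (C powr q * E) powr (1 / q)"
  proof -
    have "(C powr q * E) powr (1 / q) = (C powr q) powr (1 / q) * E powr (1 / q)" by (rule powr_mult)
    then show ?thesis using C q by (simp add: powr_powr)
  qed
  also have "ennreal \<dots> < ennreal (m L powr (1 / q))"
  proof -
    have "0 \<le> C powr q * E" using E0 by simp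
    then show ?thesis using CE q by (intro ennreal_lessI powr_less_mono2) auto
  qed
  also have "\<dots> \<le> weak_norm Mn q w"
  proof -
    let ?A = "{x \<in> space Mn. maxfun w x \<ge> ennreal 1}"
    have "ennreal 1 \<le> maxfun w (real L)"
    proof -
      have "ennreal 1 \<le> ennreal \<bar>w L (real L)\<bar>" using hit by (simp add: w_def)
      also have "\<dots> \<le> maxfun w (real L)" unfolding maxfun_def by (rule SUP_upper) simp
      finally show ?thesis .
    qed
    then have sub: "{real L} \<subseteq> ?A" by (simp add: space_Mn)
    interpret prob_space Mn by (rule prob_Mn)
    have "m L = measure Mn {real L}"
      unfolding Mn_def by (simp add: measure_pmf_single pmf_map_inj' pmf_law wt_def inj_def)
    also have "\<dots> \<le> measure Mn ?A" using sub by (intro finite_measure_mono) (auto simp: sets_Mn)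
    finally have "m L powr (1 / q) \<le> measure Mn ?A powr (1 / q)" using m_nonneg q by (intro powr_mono2) auto
    then have "ennreal (m L powr (1 / q)) \<le> ennreal 1 * epowr (emeasure Mn ?A) (1 / q)"
      by (simp add: emeasure_eq_measure epowr_def ennreal_leI)
    also have "\<dots> \<le> weak_norm Mn q w" unfolding weak_norm_def by (rule SUP_upper) simp
    finally show ?thesis .
  qed
  finally have "ennreal C * mart_norm Mn q u < weak_norm Mn q w" .
  moreover have "\<forall>n. AE x in Mn. u n x \<ge> 0" using a_nonneg d_nonneg by (simp add: u_def)
  ultimately show ?thesis
    unfolding sharpness_witness_def using prob_Mn martingale_u martingale_w transform by blast
qed

end

text \<open>From 1/2 the process jumps to \<open>R\<close> with probability
  \<open>1 / (2 * R)\<close> and to 0 otherwise; the multiplier -1 lifts the transform from 1/2 to 1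
  in the second case. As \<open>q < 1\<close>, the moment after the jump does not exceed
  \<open>(1 / 2) powr q\<close>, while the probability of reaching 1 tends to 1 with growing
  \<open>R\<close>.\<close>

lemma sharp_small_exponent:
  assumes q: "0 < q" "q < 1" and C: "0 < C" "C < 2"
  shows "sharpness_witness q C"
proof -
  have "(C / 2) powr q < 1 powr q" using q C by (intro powr_less_mono2) auto
  then have c: "0 < 1 - (C / 2) powr q" by simp
  \<comment> \<open>Large enough that the failure probability \<open>1 / (2 * R)\<close> is below
    \<open>1 - (C / 2) powr q\<close>.\<close>
  define R where "R = 1 + 1 / (1 - (C / 2) powr q)"
  have R: "1 \<le> R" "1 / (2 * R) < 1 - (C / 2) powr q"
  proof -
    show "1 \<le> R" using c by (simp add: R_def)
    have "1 < R * (1 - (C / 2) powr q)" using c by (simp add: R_def algebra_simps)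
    then show "1 / (2 * R) < 1 - (C / 2) powr q" using \<open>1 \<le> R\<close> by (simp add: field_simps)
  qed
  define a m v where "a = (\<lambda>k::nat. if k = 0 then 1 / 2 else 0 :: real)"
    and "m = (\<lambda>k::nat. if k = 0 then 1 else 1 - 1 / (2 * R))" and "v = (\<lambda>k::nat. if k = 0 then 1 else - 1 :: real)"
  interpret dying_chain a "\<lambda>_. R" m v 1
  proof
    have "1 / (2 * R) \<le> 1" using R by simp
    then show "0 \<le> m k" "m (Suc k) \<le> m k" for k using R by (auto simp: m_def)
    show "m k * a k = m (Suc k) * a (Suc k) + (m k - m (Suc k)) * R" if "k < 1" for k
      using that R by (simp add: a_def m_def)
  qed (use R in \<open>auto simp: a_def m_def v_def\<close>)
  show ?thesis
  proof (rule witness[OF q(1) C(1), where E="(1 / 2) powr q"])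
    show "1 \<le> \<bar>b 1\<bar>" unfolding b_def by (simp add: a_def v_def)
    show "(\<Sum>k<n. (m k - m (Suc k)) * R powr q) + m n * a n powr q \<le> (1 / 2) powr q" if "n \<le> 1" for n
    proof (cases "n = 0")
      case True then show ?thesis by (simp add: m_def a_def)
    next
      case False
      then have n: "n = 1" using that by simp
      have "1 / (2 * R) * R powr q = 1 / 2 * R powr (q - 1)" using R by (simp add: powr_diff)
      also have "\<dots> \<le> 1 / 2 * (1 / 2) powr (q - 1)" using R q by (intro mult_left_mono powr_mono2') auto
      also have "\<dots> = (1 / 2) powr q" by (simp add: powr_diff)
      finally show ?thesis by (simp add: n m_def a_def)
    qed
    have "C powr q * (1 / 2) powr q = (C / 2) powr q" by (simp only: powr_mult[symmetric]) simp
    then show "C powr q * (1 / 2) powr q < m 1" using R by (simp add: m_def)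
  qed
qed

text \<open>Some chain started at \<open>(x, y)\<close> reaches \<open>y \<ge> 1\<close> alive with probability \<open>P\<close>, and the \<open>q\<close>-th moment of
  its final first coordinate is \<open>E\<close>.\<close>
definition reaches :: "real \<Rightarrow> real \<Rightarrow> real \<Rightarrow> real \<Rightarrow> real \<Rightarrow> bool" where
  "reaches q x y P E \<longleftrightarrow> (\<exists>a d m v L. dying_chain a d m v L \<and> a 0 = x \<and>
      1 \<le> y + (\<Sum>k<L. v (Suc k) * (a (Suc k) - a k)) \<and> m L = P \<and>
      (\<Sum>k<L. (m k - m (Suc k)) * d (Suc k) powr q) + m L * a L powr q = E)"

section \<open>Composed chains for exponents at least 2\<close>

lemma reaches_refl:
  assumes "0 \<le> x" "1 \<le> y" shows "reaches q x y 1 (x powr q)"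
  unfolding reaches_def
  by (intro exI[of _ "\<lambda>_. x"] exI[of _ "\<lambda>_. 0"] exI[of _ "\<lambda>_. 1"] exI[of _ 0])
    (use assms in \<open>auto simp: dying_chain_def\<close>)

text \<open>Prepending a step scales all later survival probabilities by \<open>t\<close>: the chain
  goes to \<open>x'\<close> with probability \<open>t\<close> and dies at \<open>z\<close>
  otherwise. The equation for \<open>x\<close> is the martingale condition.\<close>

lemma reaches_step:
  assumes r: "reaches q x' (y + \<sigma> * (x' - x)) P E" and x: "0 \<le> x" "x = t * x' + (1 - t) * z"
    and t: "0 \<le> t" "t \<le> 1" and z: "0 \<le> z" and \<sigma>: "\<bar>\<sigma>\<bar> \<le> 1"
  shows "reaches q x y (t * P) (t * E + (1 - t) * z powr q)"
proof -
  obtain a d m v L where ch: "dying_chain a d m v L" and h: "a 0 = x'"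
      "1 \<le> y + \<sigma> * (x' - x) + (\<Sum>k<L. v (Suc k) * (a (Suc k) - a k))" "m L = P"
      "(\<Sum>k<L. (m k - m (Suc k)) * d (Suc k) powr q) + m L * a L powr q = E"
    using r unfolding reaches_def by blast
  interpret dying_chain a d m v L by fact
  define a' m' where "a' = case_nat x a" and "m' = case_nat 1 (\<lambda>k. t * m k)"
  define d' v' where "d' = case_nat 0 (case_nat z (\<lambda>k. d (Suc k)))" and "v' = case_nat 0 (case_nat \<sigma> (\<lambda>k. v (Suc k)))"
  have "dying_chain a' d' m' v' (Suc L)"
  proof
    show "m' (Suc k) \<le> m' k" for k
      using m_dec t m0 by (cases k) (auto simp: m'_def intro: mult_left_mono)
    show "m' k * a' k = m' (Suc k) * a' (Suc k) + (m' k - m' (Suc k)) * d' (Suc k)" if "k < Suc L" for k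
    proof (cases k)
      case 0 then show ?thesis using x h(1) m0 by (simp add: m'_def a'_def d'_def)
    next
      case (Suc i)
      then have "t * (m i * a i) = t * (m (Suc i) * a (Suc i) + (m i - m (Suc i)) * d (Suc i))"
        using balance[of i] that by simp
      then show ?thesis using Suc by (simp add: m'_def a'_def d'_def algebra_simps)
    qed
  qed (use x z t \<sigma> a_nonneg d_nonneg m_nonneg v_le in \<open>auto simp: m'_def a'_def d'_def v'_def split: nat.split\<close>)
  moreover have "1 \<le> y + (\<Sum>k<Suc L. v' (Suc k) * (a' (Suc k) - a' k))"
    using h(1,2) by (simp add: sum.lessThan_Suc_shift a'_def v'_def algebra_simps del: sum.lessThan_Suc)
  moreover have "(\<Sum>k<Suc L. (m' k - m' (Suc k)) * d' (Suc k) powr q) + m' (Suc L) * a' (Suc L) powr q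
      = t * E + (1 - t) * z powr q"
  proof -
    have "(\<Sum>k<Suc L. (m' k - m' (Suc k)) * d' (Suc k) powr q)
      = (1 - t) * z powr q + (\<Sum>k<L. t * ((m k - m (Suc k)) * d (Suc k) powr q))"
      using m0 by (simp add: sum.lessThan_Suc_shift m'_def d'_def algebra_simps del: sum.lessThan_Suc)
    moreover have "m' (Suc L) * a' (Suc L) powr q = t * (m L * a L powr q)" by (simp add: m'_def a'_def)
    ultimately show ?thesis
      unfolding h(4)[symmetric] by (simp only: sum_distrib_left[symmetric] distrib_left add_ac)
  qed
  moreover have "a' 0 = x" "m' (Suc L) = t * P" using h(3) by (simp_all add: a'_def m'_def)
  ultimately show ?thesis unfolding reaches_def by blast
qed

text \<open>The norm is a supremum over time, but for \<open>q \<ge> 1\<close> the moments increase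
  (Jensen, via the tangent at \<open>a n\<close>), so the final moment \<open>E\<close> bounds them
  all.\<close>

lemma witness_if_reaches:
  assumes r: "reaches q x x P E" and q: "1 \<le> q" and C: "0 < C" and CE: "C powr q * E < P"
  shows "sharpness_witness q C"
proof -
  obtain a d m v L where ch: "dying_chain a d m v L" and h: "a 0 = x"
      "1 \<le> x + (\<Sum>k<L. v (Suc k) * (a (Suc k) - a k))" "m L = P"
      "(\<Sum>k<L. (m k - m (Suc k)) * d (Suc k) powr q) + m L * a L powr q = E"
    using r unfolding reaches_def by blast
  interpret A: dying_chain a d m v L by fact
  \<comment> \<open>The first multiplier 1 makes the transform start at \<open>x\<close> too, that
    is at the point \<open>(x, x)\<close>.\<close>
  interpret dying_chain a d m "v(0 := 1)" L
    by unfold_locales (use A.m0 A.m_dec A.m_nonneg A.a_nonneg A.d_nonneg A.balance A.v_le in auto)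
  define e where "e n = (\<Sum>k<n. (m k - m (Suc k)) * d (Suc k) powr q) + m n * a n powr q" for n
  have step: "e n \<le> e (Suc n)" if n: "n < L" for n
  proof (cases "m n = 0 \<or> a n = 0")
    case True
    then have "m n * a n powr q = 0" by auto
    moreover have "0 \<le> (m n - m (Suc n)) * d (Suc n) powr q" "0 \<le> m (Suc n) * a (Suc n) powr q"
      using m_dec[of n] m_nonneg by auto
    ultimately show ?thesis unfolding e_def sum.lessThan_Suc by linarith
  next
    case False
    then have an: "0 < a n" using a_nonneg[of n] by simp
    let ?T = "\<lambda>z. a n powr q + q * a n powr (q - 1) * (z - a n)"
    have "m n * a n powr q = (m n - m (Suc n)) * ?T (d (Suc n)) + m (Suc n) * ?T (a (Suc n))"
    proof -
      have "(m n - m (Suc n)) * ?T (d (Suc n)) + m (Suc n) * ?T (a (Suc n)) = m n * a n powr q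
        + q * a n powr (q - 1) * (m (Suc n) * a (Suc n) + (m n - m (Suc n)) * d (Suc n) - m n * a n)"
        by (simp add: algebra_simps)
      then show ?thesis using balance[OF n] by simp
    qed
    also have "\<dots> \<le> (m n - m (Suc n)) * d (Suc n) powr q + m (Suc n) * a (Suc n) powr q"
      using m_dec[of n] m_nonneg a_nonneg d_nonneg an q
      by (intro add_mono mult_left_mono powr_ge_tangent_at) auto
    finally show ?thesis by (simp add: e_def)
  qed
  have "e n \<le> e L" if "n \<le> L" for n
    using that by (induction rule: inc_induct) (use step in \<open>auto intro: order_trans\<close>)
  then show ?thesis
    by (intro witness[where E=E]) (use q C CE h in \<open>auto simp: b_def e_def\<close>)
qed

text \<open>The bound on \<open>E\<close> is homogeneous of degree \<open>q\<close> in \<open>s\<close>, while the probability decays like \<open>s\<^sup>q\<^sup>-\<^sup>1\<close> for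
  small \<open>\<eta>\<close>, so the loss of starting far down the ray is negligible; \<open>\<kappa>\<close> may be taken close to \<open>q / 2 - 1\<close>.\<close>
lemma reaches_from_ray:
  fixes q \<eta> \<kappa> :: real
  defines "D \<equiv> (q / 2 - 1) * \<eta> / (1 + \<eta>)" and "t \<equiv> 1 / (1 + q * \<eta> / 2)"
  assumes q: "2 \<le> q" and \<eta>: "0 < \<eta>" and D: "D \<le> 1" and \<kappa>: "0 \<le> \<kappa>"
    and pot: "t * (1 + \<eta>) powr q * D \<le> \<kappa> * (t * (1 - D) * (1 + \<eta>) powr q - 1)"
    and s: "s = inverse ((1 + \<eta>) ^ n)"
  shows "\<exists>E. reaches q (s / q) (s - s / q) ((t * (1 - D)) ^ n / 2) E \<and>
    E \<le> (2 / q) powr q * ((1 + 2 * \<kappa>) * ((t * (1 - D)) ^ n / 2) - \<kappa> * s powr q)"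
  using s
proof (induction n arbitrary: s)
  case 0
  \<comment> \<open>The final jump along \<open>s = 1\<close>, from the ray to \<open>(0, 1)\<close>
    or to \<open>x = 2 / q\<close>, each with probability 1/2. The claimed bound is an equality
    here.\<close>
  have "reaches q 0 (1 - 1 / q + (- 1) * (0 - 1 / q)) 1 (0 powr q)" by (rule reaches_refl) auto
  then have "reaches q (1 / q) (1 - 1 / q) (1 / 2 * 1) (1 / 2 * 0 powr q + (1 - 1 / 2) * (2 / q) powr q)"
    by (rule reaches_step) (use q in auto)
  then show ?case using 0 by (intro exI conjI) (assumption | simp add: algebra_simps)+
next
  case (Suc n)
  define s' where "s' = inverse ((1 + \<eta>) ^ n)"
  define P where "P = (t * (1 - D)) ^ n / 2"
  obtain E where E: "reaches q (s' / q) (s' - s' / q) P E"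
    "E \<le> (2 / q) powr q * ((1 + 2 * \<kappa>) * P - \<kappa> * s' powr q)"
    using Suc.IH[OF s'_def] by (auto simp: P_def)
  have "s = inverse (1 + \<eta>) * s'" "0 < s'" using Suc.prems \<eta> by (auto simp: s'_def)
  then have s': "s' = (1 + \<eta>) * s" "0 < s" using \<eta> by (auto simp: mult.assoc[symmetric])
  have D0: "0 \<le> D" using q \<eta> by (simp add: D_def)
  have "0 < q * \<eta>" using q \<eta> by simp
  then have "0 < 1 + q * \<eta> / 2" "1 \<le> 1 + q * \<eta> / 2" by simp_all
  then have t: "0 < t" "t \<le> 1" "t * (1 + q * \<eta> / 2) = 1" by (simp_all add: t_def)
  \<comment> \<open>Along slope 1 half of the increase from \<open>s\<close> to \<open>s'\<close>
    goes into \<open>x\<close>. The result is \<open>(1 + D) * s' / q\<close>, so the return to the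
    ray succeeds with probability \<open>1 - D\<close>.\<close>
  define x where "x = s / q + (s' - s) / 2"
  have x_eq: "x = (1 - D) * (s' / q) + (1 - (1 - D)) * (2 * s' / q)"
  proof -
    have "D * s' = (q / 2 - 1) * (s' - s)" using s' \<eta> by (simp add: D_def field_simps)
    then have "(1 + D) * s' = s + q * (s' - s) / 2" by (simp add: algebra_simps)
    moreover have "x = (s + q * (s' - s) / 2) / q" using q by (simp add: x_def add_divide_distrib)
    ultimately have "x = (1 + D) * (s' / q)" by simp
    also have "(1 + D) * z = (1 - D) * z + (1 - (1 - D)) * (2 * z)" for z by (simp add: algebra_simps)
    finally show ?thesis by simp
  qed
  have x0: "0 \<le> x" using s' q \<eta> by (simp add: x_def)
  have "reaches q x (s - s / q + 1 * (x - s / q)) ((1 - D) * P) ((1 - D) * E + (1 - (1 - D)) * (2 * s' / q) powr q)"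
  proof (rule reaches_step[where \<sigma>="- 1"])
    have "s - s / q + 1 * (x - s / q) + - 1 * (s' / q - x) = s' - s' / q"
      by (simp add: x_def field_simps)
    then show "reaches q (s' / q) (s - s / q + 1 * (x - s / q) + - 1 * (s' / q - x)) P E" by (simp only: E(1))
  qed (use x_eq x0 D D0 s' \<eta> q in auto)
  then have R: "reaches q (s / q) (s - s / q) (t * ((1 - D) * P))
     (t * ((1 - D) * E + (1 - (1 - D)) * (2 * s' / q) powr q) + (1 - t) * 0 powr q)"
  proof (rule reaches_step)
    have "x = (1 + q * \<eta> / 2) * (s / q)" using s' q by (simp add: x_def field_simps)
    then have "t * x = s / q" using t(3) by (metis mult.assoc mult_1)
    then show "s / q = t * x + (1 - t) * 0" by simp
  qed (use s' q t in auto)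
  have s'q: "(2 * s' / q) powr q = (2 / q) powr q * s' powr q" "s' powr q = (1 + \<eta>) powr q * s powr q"
    by (simp_all only: powr_mult[symmetric] s'(1)) simp
  have "t * ((1 - D) * E + D * ((2 / q) powr q * s' powr q))
      \<le> t * ((1 - D) * ((2 / q) powr q * ((1 + 2 * \<kappa>) * P - \<kappa> * s' powr q)) + D * ((2 / q) powr q * s' powr q))"
    using E(2) t D by (intro mult_left_mono add_right_mono) auto
  \<comment> \<open>The term in \<open>P\<close> reproduces itself; \<open>pot\<close> says exactly
    that the additional coefficient of \<open>s powr q\<close> is nonpositive.\<close>
  also have "\<dots> = (2 / q) powr q * ((1 + 2 * \<kappa>) * (t * (1 - D) * P)
      + (t * (1 + \<eta>) powr q * D - \<kappa> * (t * (1 - D) * (1 + \<eta>) powr q - 1)) * s powr q - \<kappa> * s powr q)"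
    unfolding s'q(2) by (simp add: algebra_simps)
  also have "\<dots> \<le> (2 / q) powr q * ((1 + 2 * \<kappa>) * (t * (1 - D) * P) - \<kappa> * s powr q)"
    using pot by (intro mult_left_mono) (auto intro: mult_nonpos_nonneg)
  finally have "t * ((1 - D) * E + (1 - (1 - D)) * (2 * s' / q) powr q) + (1 - t) * 0 powr q
      \<le> (2 / q) powr q * ((1 + 2 * \<kappa>) * (t * (1 - D) * P) - \<kappa> * s powr q)"
    using q by (simp add: s'q(1))
  moreover have "t * ((1 - D) * P) = (t * (1 - D)) ^ Suc n / 2" "t * (1 - D) * P = (t * (1 - D)) ^ Suc n / 2"
    by (simp_all add: P_def)
  ultimately show ?case using R by (intro exI conjI) (simp_all only:)
qed

lemma sharp_large_exponent:
  assumes q: "2 \<le> q" and C: "0 < C" "C < q / 2 * (q - 1) powr (- 1 / q)"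
  shows "sharpness_witness q C"
proof -
  define A where "A = C powr q * (2 / q) powr q"
  have A: "0 < A" "A * (q - 1) < 1"
  proof -
    show "0 < A" using C q by (simp add: A_def)
    have "C powr q < (q / 2 * (q - 1) powr (- 1 / q)) powr q" using C q by (intro powr_less_mono2) auto
    also have "\<dots> = (q / 2) powr q * ((q - 1) powr (- 1 / q)) powr q" by (rule powr_mult)
    also have "((q - 1) powr (- 1 / q)) powr q = (q - 1) powr (- 1 / q * q)" by (rule powr_powr)
    also have "- 1 / q * q = - 1" using q by simp
    also have "(q - 1) powr - 1 = 1 / (q - 1)" using q by (simp add: powr_minus_divide)
    finally have "C powr q * (2 / q) powr q < (q / 2) powr q * (1 / (q - 1)) * (2 / q) powr q"
      using q by (intro mult_strict_right_mono) auto
    also have "\<dots> = (q / 2 * (2 / q)) powr q * (1 / (q - 1))" by (simp only: powr_mult mult_ac)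
    finally show "A * (q - 1) < 1" using q by (simp add: A_def field_simps)
  qed
  \<comment> \<open>The solution of \<open>pot\<close> with equality after estimating
    \<open>D \<le> (q / 2 - 1) * \<eta>\<close> and using the bound \<open>gap\<close>. As
    \<open>\<eta>\<close> tends to 0, \<open>1 + 2 * k \<eta>\<close> tends to \<open>q - 1\<close>,
    so the bound on \<open>E / P\<close> tends to \<open>(2 / q) powr q * (q - 1)\<close>, the
    reciprocal of the \<open>q\<close>-th power of the sharp constant.\<close>
  define k where "k = (\<lambda>\<eta>. (1 + \<eta>) powr q * (q / 2 - 1) / (1 - q * (q / 2 - 1) * \<eta>))"
  have "((\<lambda>\<eta>. A * (1 + 2 * k \<eta>)) \<longlongrightarrow> A * (1 + 2 * ((1 + 0) powr q * (q / 2 - 1) / (1 - q * (q / 2 - 1) * 0)))) (at_right 0)"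
    unfolding k_def by (intro tendsto_intros) auto
  then have lim: "((\<lambda>\<eta>. A * (1 + 2 * k \<eta>)) \<longlongrightarrow> A * (q - 1)) (at_right 0)" by simp
  have lim2: "((\<lambda>\<eta>. q * (q / 2 - 1) * \<eta>) \<longlongrightarrow> q * (q / 2 - 1) * 0) (at_right 0)"
    by (intro tendsto_intros)
  have "\<forall>\<^sub>F \<eta> in at_right 0. A * (1 + 2 * k \<eta>) < 1 \<and> q * (q / 2 - 1) * \<eta> < 1 \<and> 0 < \<eta>"
    using order_tendstoD(2)[OF lim A(2)] order_tendstoD(2)[OF lim2, of 1] eventually_at_right_less[of 0]
    by (auto intro!: eventually_conj)
  then obtain \<eta> where \<eta>: "A * (1 + 2 * k \<eta>) < 1" "q * (q / 2 - 1) * \<eta> < 1" "0 < \<eta>"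
    using eventually_happens[of _ "at_right (0::real)"] by auto
  define \<kappa> where "\<kappa> = k \<eta>"
  define D t where "D = (q / 2 - 1) * \<eta> / (1 + \<eta>)" and "t = 1 / (1 + q * \<eta> / 2)"
  have \<kappa>: "0 \<le> \<kappa>" using \<eta> q by (simp add: \<kappa>_def k_def)
  have D: "0 \<le> D" "D \<le> (q / 2 - 1) * \<eta>" using q \<eta> by (auto simp: D_def field_simps)
  have "1 * ((q / 2 - 1) * \<eta>) \<le> q * ((q / 2 - 1) * \<eta>)" using q \<eta> by (intro mult_right_mono) auto
  then have D1: "D < 1" using D \<eta> by simp
  have "0 < q * \<eta>" using q \<eta> by simp
  then have "0 < 1 + q * \<eta> / 2" by simp
  then have t: "0 < t" "t * (1 + q * \<eta> / 2) = 1" by (simp_all add: t_def)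
  note t1 = t(2)
  let ?r = "(1 + \<eta>) powr q"
  have r: "1 + q * \<eta> \<le> ?r" using powr_ge_tangent[of "1 + \<eta>" q] q \<eta> by simp
  have gap: "\<eta> * (1 - q * (q / 2 - 1) * \<eta>) \<le> ?r * (1 - D) - (1 + q * \<eta> / 2)"
  proof -
    have "(1 + q * \<eta>) * (1 - (q / 2 - 1) * \<eta>) \<le> ?r * (1 - D)"
      using r D D1 q \<eta> by (intro order_trans[OF mult_left_mono mult_right_mono]) auto
    then show ?thesis by (simp add: field_simps)
  qed
  have gap0: "0 < \<eta> * (1 - q * (q / 2 - 1) * \<eta>)" using \<eta> by simp
  have theta: "t * (1 - D) * ?r - 1 = t * (?r * (1 - D) - (1 + q * \<eta> / 2))"
    using t1 by (simp add: algebra_simps)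
  have pot: "t * ?r * D \<le> \<kappa> * (t * (1 - D) * ?r - 1)"
  proof -
    have "?r * D \<le> ?r * ((q / 2 - 1) * \<eta>)" using D by (intro mult_left_mono) auto
    also have "\<dots> = \<kappa> * (\<eta> * (1 - q * (q / 2 - 1) * \<eta>))" using \<eta> by (simp add: \<kappa>_def k_def)
    also have "\<dots> \<le> \<kappa> * (?r * (1 - D) - (1 + q * \<eta> / 2))" using gap \<kappa> by (intro mult_left_mono)
    finally have "t * (?r * D) \<le> t * (\<kappa> * (?r * (1 - D) - (1 + q * \<eta> / 2)))" using t by (intro mult_left_mono) auto
    then show ?thesis unfolding theta by (simp add: mult_ac)
  qed
  define \<theta> where "\<theta> = t * (1 - D)"
  have \<theta>: "0 < \<theta>" "1 < \<theta> * ?r"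
    using t D1 theta gap gap0 by (auto simp: \<theta>_def) (smt (verit) mult_pos_pos)
  \<comment> \<open>The probability of getting from the diagonal point \<open>(s / 2, s / 2)\<close>
    along slope -1 to the ray at \<open>x = s / q\<close>, the alternative being
    \<open>x = s\<close>.\<close>
  define \<alpha> where "\<alpha> = q / (2 * (q - 1))"
  have \<alpha>: "0 < \<alpha>" "\<alpha> \<le> 1" using q by (auto simp: \<alpha>_def field_simps)
  \<comment> \<open>The slack left by \<open>A * (1 + 2 * \<kappa>) < 1\<close>, which has to absorb
    the cost of the initial step.\<close>
  define c where "c = \<alpha> * (1 - A * (1 + 2 * \<kappa>)) / 2"
  have c: "0 < c" using \<alpha> \<eta> by (simp add: c_def \<kappa>_def)
  \<comment> \<open>That cost is at most \<open>C powr q * s powr q\<close> with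
    \<open>s powr q = inverse (?r ^ n)\<close>. Since \<open>\<theta> * ?r > 1\<close>, it falls
    below \<open>c * \<theta> ^ n\<close> when the start is far enough down the ray.\<close>
  obtain n where n: "C powr q / c < (\<theta> * ?r) ^ n" using real_arch_pow[OF \<theta>(2)] by blast
  define s where "s = inverse ((1 + \<eta>) ^ n)"
  have s0: "0 < s" using \<eta> by (simp add: s_def)
  obtain E where E: "reaches q (s / q) (s - s / q) (\<theta> ^ n / 2) E"
    "E \<le> (2 / q) powr q * ((1 + 2 * \<kappa>) * (\<theta> ^ n / 2) - \<kappa> * s powr q)"
    using reaches_from_ray[OF q \<eta>(3) _ \<kappa> _ s_def] D1 pot unfolding \<theta>_def D_def t_def by force
  have "reaches q (s / 2) (s / 2) (\<alpha> * (\<theta> ^ n / 2)) (\<alpha> * E + (1 - \<alpha>) * s powr q)"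
  proof (rule reaches_step[where \<sigma>="- 1"])
    have "s / 2 + - 1 * (s / q - s / 2) = s - s / q" by simp
    then show "reaches q (s / q) (s / 2 + - 1 * (s / q - s / 2)) (\<theta> ^ n / 2) E" by (simp only: E(1))
    have "1 - 1 / q = (q - 1) / q" using q by (simp add: diff_divide_distrib)
    then have half: "\<alpha> * (1 - 1 / q) = 1 / 2" using q by (simp add: \<alpha>_def)
    have "\<alpha> * (s / q) + (1 - \<alpha>) * s = s - s * (\<alpha> * (1 - 1 / q))" by (simp add: algebra_simps)
    then show "s / 2 = \<alpha> * (s / q) + (1 - \<alpha>) * s" unfolding half by simp
  qed (use s0 \<alpha> in auto)
  moreover have "C powr q * (\<alpha> * E + (1 - \<alpha>) * s powr q) < \<alpha> * (\<theta> ^ n / 2)"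
  proof -
    have sq: "s powr q = inverse (?r ^ n)"
      using \<eta> by (simp add: s_def powr_realpow[symmetric] powr_powr powr_minus[symmetric] mult.commute)
    note E(2)
    also have "(2 / q) powr q * ((1 + 2 * \<kappa>) * (\<theta> ^ n / 2) - \<kappa> * s powr q)
        \<le> (2 / q) powr q * ((1 + 2 * \<kappa>) * (\<theta> ^ n / 2))"
      using \<kappa> by (intro mult_left_mono) auto
    finally have "C powr q * (\<alpha> * E) \<le> C powr q * (\<alpha> * ((2 / q) powr q * ((1 + 2 * \<kappa>) * (\<theta> ^ n / 2))))"
      using \<alpha> by (intro mult_left_mono) auto
    also have "\<dots> = \<alpha> * (\<theta> ^ n / 2) - c * \<theta> ^ n" by (simp add: A_def c_def field_simps)
    finally have 1: "C powr q * (\<alpha> * E) \<le> \<alpha> * (\<theta> ^ n / 2) - c * \<theta> ^ n" .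
    have "C powr q * ((1 - \<alpha>) * s powr q) \<le> C powr q * (1 * s powr q)"
      using \<alpha> by (intro mult_left_mono mult_right_mono) auto
    also have "\<dots> < c * \<theta> ^ n"
    proof -
      have "0 < ?r ^ n" using \<eta> by simp
      moreover have "C powr q < c * (\<theta> ^ n * ?r ^ n)" using n c by (simp add: field_simps power_mult_distrib)
      ultimately show ?thesis unfolding sq by (simp add: field_simps)
    qed
    finally show ?thesis using 1 by (simp add: distrib_left)
  qed
  ultimately show ?thesis using q C(1) by (intro witness_if_reaches) auto
qed

theorem theorem1p4:
  fixes M :: "'a measure" and F :: "nat \<Rightarrow> 'a measure"
    and f g :: "nat \<Rightarrow> 'a \<Rightarrow> real" and p :: real
  assumes "prob_space M"
    and "is_martingale M F f" and "is_martingale M F g"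
    and "\<forall>n. AE x in M. f n x \<ge> 0"
    and "diff_subordinate M g f"
  shows "(0 < p \<and> p < 1 \<longrightarrow> weak_norm M p g \<le> ennreal 2 * mart_norm M p f)
    \<and> (2 \<le> p \<longrightarrow> weak_norm M p g \<le> ennreal (p / 2 * (p - 1) powr (- 1 / p)) * mart_norm M p f)
    \<and> (\<forall>q C. 0 < q \<and> q < 1 \<and> 0 < C \<and> C < 2 \<longrightarrow>
         (\<exists>(N :: real measure) G u w. prob_space N \<and> is_martingale N G u \<and> is_martingale N G w
            \<and> (\<forall>n. AE x in N. u n x \<ge> 0) \<and> is_transform N G u w
            \<and> weak_norm N q w > ennreal C * mart_norm N q u))
    \<and> (\<forall>q C. 2 \<le> q \<and> 0 < C \<and> C < q / 2 * (q - 1) powr (- 1 / q) \<longrightarrow>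
         (\<exists>(N :: real measure) G u w. prob_space N \<and> is_martingale N G u \<and> is_martingale N G w
            \<and> (\<forall>n. AE x in N. u n x \<ge> 0) \<and> is_transform N G u w
            \<and> weak_norm N q w > ennreal C * mart_norm N q u))"
  using weak_norm_bounds[OF assms] sharp_small_exponent sharp_large_exponent
  unfolding sharpness_witness_def by blast

end
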